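(* Let $(y_1,x_1),\ldots,(y_n,x_n)$ be independent and identically distributed with $x\sim N(0,I_p)$ ($I_p$ the $p\times p$ identity) and $y\mid x=x_0\sim N(\beta^Tx_0,\sigma^2)$, where $\beta\in\mathbb{R}^p$ and $\sigma^2>0$ are unknown. Let $X$ be the $n\times p$ matrix with rows $x_i^T$, $Y=(y_1,\ldots,y_n)^T$, $\mu=X\beta$, and define \[ \hat\sigma^2_{Dicker}=\frac{p+n+1}{n(n+1)}\|Y\|^2-\frac{1}{n(n+1)}\|X^TY\|^2 . \] Assume $p=p_n$ with $p/n\to c$ as $n\to\infty$ for some $c\in[1,\infty)$, and that $\sigma^2$ and $\|\beta\|^2$ are bounded as $n\to\infty$. Then there exist a sequence of sets $A_n$ (of $n\times p$ matrices) and a constant $C$ such that $\mathrm{pr}(X\in A_n)\to1$ as $n\to\infty$, and for $X\in A_n$ and any $\xi>0$, \[ \mathrm{pr}_X\left(|\hat\sigma^2_{Dicker}-\sigma^2|\ge\xi\right)\le C\,\frac{g(c,n,\mu,\sigma^2)}{\xi^2\sqrt n}, \] where \[ g(c,n,\mu,\sigma^2)=1+2(c+1)\left\{\left(\tfrac1n\|\mu\|^2\right)^2+\sigma^4\right\}+\frac{4\sigma^2}{n}\|\mu\|^2+2\sigma^4 . \]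
   Context: $\mathrm{pr}_X$ denotes probability conditional on the design matrix $X$ (i.e., for fixed $X$, only $Y$ is random, with $y_i\sim N(\mu_i,\sigma^2)$ independently, $\mu_i=x_i^T\beta$), while $\mathrm{pr}(X\in A_n)$ is the unconditional probability under $x_i\sim N(0,I_p)$ i.i.d. $\|\cdot\|$ is the Euclidean norm. *)

theory Defs
  imports "HOL-Probability.Probability"
begin

text \<open>An n x p design matrix is represented as a function on index pairs (i,j),
  i < n (row), j < p (column). Vectors in R^n are functions nat => real on {..<n}.\<close>

text \<open>Law of the random design: entries i.i.d. N(0,1), i.e. rows x_i ~ N(0, I_p) i.i.d.\<close>
definition design_dist :: "nat \<Rightarrow> nat \<Rightarrow> (nat \<times> nat \<Rightarrow> real) measure" where
  "design_dist n p = PiM ({..<n} \<times> {..<p}) (\<lambda>_. density lborel std_normal_density)"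

definition mean_vec :: "nat \<Rightarrow> (nat \<times> nat \<Rightarrow> real) \<Rightarrow> (nat \<Rightarrow> real) \<Rightarrow> nat \<Rightarrow> real" where
  "mean_vec p X \<beta> i = (\<Sum>j<p. X (i, j) * \<beta> j)"

text \<open>Conditional law of Y given X: y_i ~ N(mu_i, sigma^2) independently (sigma2 is the variance).\<close>
definition response_dist ::
  "nat \<Rightarrow> nat \<Rightarrow> (nat \<times> nat \<Rightarrow> real) \<Rightarrow> (nat \<Rightarrow> real) \<Rightarrow> real \<Rightarrow> (nat \<Rightarrow> real) measure" where
  "response_dist n p X \<beta> sigma2 =
     PiM {..<n} (\<lambda>i. density lborel (normal_density (mean_vec p X \<beta> i) (sqrt sigma2)))"

definition sqnorm :: "nat \<Rightarrow> (nat \<Rightarrow> real) \<Rightarrow> real" where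
  "sqnorm n v = (\<Sum>i<n. (v i)\<^sup>2)"

definition XtY :: "nat \<Rightarrow> (nat \<times> nat \<Rightarrow> real) \<Rightarrow> (nat \<Rightarrow> real) \<Rightarrow> nat \<Rightarrow> real" where
  "XtY n X Y j = (\<Sum>i<n. X (i, j) * Y i)"

definition sigma2_dicker :: "nat \<Rightarrow> nat \<Rightarrow> (nat \<times> nat \<Rightarrow> real) \<Rightarrow> (nat \<Rightarrow> real) \<Rightarrow> real" where
  "sigma2_dicker n p X Y =
     (real p + real n + 1) / (real n * (real n + 1)) * sqnorm n Y
     - 1 / (real n * (real n + 1)) * sqnorm p (XtY n X Y)"

definition g_fun :: "real \<Rightarrow> nat \<Rightarrow> real \<Rightarrow> real \<Rightarrow> real" where
  "g_fun c n mu_sq sigma2 =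
     1 + 2 * (c + 1) * ((mu_sq / real n)\<^sup>2 + sigma2\<^sup>2) + 4 * sigma2 / real n * mu_sq + 2 * sigma2\<^sup>2"

end

theory Submission
  imports Defs
begin

text \<open>
  Let \<open>W X\<close> be the conditional mean square error of the estimator given the design. By Chebyshev
  the conditional deviation probability is at most \<open>W X / \<xi>\<^sup>2\<close>, and \<open>g \<ge> 1\<close>, so \<open>C = 1\<close> and
  \<open>A\<^sub>n = {X. W X < 1 / \<surd>n}\<close> work as soon as \<open>E W = O(1/n)\<close>, by Markov's inequality.
  Now \<open>E W\<close> is the unconditional mean square error. With \<open>z\<^sub>i = y\<^sub>i x\<^sub>i\<close>, which has mean \<open>\<beta>\<close>, and
  \<open>w\<^sub>i = z\<^sub>i - \<beta>\<close>, the error times \<open>n (n + 1)\<close> is a sum of \<open>n\<close> independent centered variables,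
  one for each row and of second moment \<open>O(n\<^sup>2)\<close>, minus the degenerate U-statistic
  \<open>2 \<Sum>\<^bsub>i<k\<^esub> w\<^sub>i \<bullet> w\<^sub>k\<close>. The latter is a sum of martingale differences, with second moment \<open>O(n\<^sup>2 p)\<close>
  because \<open>E (w \<bullet> v)\<^sup>2 = O(\<parallel>v\<parallel>\<^sup>2)\<close>. Both contributions are \<open>O(n\<^sup>3)\<close>.
\<close>

section \<open>Second moments of sums of independent vectors\<close>

lemma integrable_mult_of_square_integrable:
  fixes f g :: "'a \<Rightarrow> real"
  assumes [measurable]: "f \<in> borel_measurable M" "g \<in> borel_measurable M"
    and f2: "integrable M (\<lambda>x. (f x)\<^sup>2)" and g2: "integrable M (\<lambda>x. (g x)\<^sup>2)"
  shows "integrable M (\<lambda>x. f x * g x)"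
proof (rule Bochner_Integration.integrable_bound[OF Bochner_Integration.integrable_add[OF f2 g2]])
  show "AE x in M. norm (f x * g x) \<le> norm ((f x)\<^sup>2 + (g x)\<^sup>2)"
  proof (rule AE_I2)
    fix x
    have "2 * (\<bar>f x\<bar> * \<bar>g x\<bar>) \<le> (f x)\<^sup>2 + (g x)\<^sup>2"
      using zero_le_power2[of "\<bar>f x\<bar> - \<bar>g x\<bar>"] by (simp add: power2_diff mult.assoc)
    then show "norm (f x * g x) \<le> norm ((f x)\<^sup>2 + (g x)\<^sup>2)"
      using mult_nonneg_nonneg[of "\<bar>f x\<bar>" "\<bar>g x\<bar>"] unfolding real_norm_def abs_mult by linarith
  qed
qed simp

lemma square_integrable_add:
  fixes f g :: "'a \<Rightarrow> real"
  assumes [measurable]: "f \<in> borel_measurable M" "g \<in> borel_measurable M"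
    and "integrable M (\<lambda>x. (f x)\<^sup>2)" "integrable M (\<lambda>x. (g x)\<^sup>2)"
  shows "integrable M (\<lambda>x. (f x + g x)\<^sup>2)"
proof -
  have "integrable M (\<lambda>x. (f x)\<^sup>2 + (g x)\<^sup>2 + 2 * (f x * g x))"
    using assms integrable_mult_of_square_integrable[of f M g] by simp
  then show ?thesis
    by (simp add: power2_sum mult.assoc)
qed

lemma square_integrable_sum:
  fixes f :: "'i \<Rightarrow> 'a \<Rightarrow> real"
  assumes "finite I" "\<And>i. i \<in> I \<Longrightarrow> f i \<in> borel_measurable M"
    and "\<And>i. i \<in> I \<Longrightarrow> integrable M (\<lambda>x. (f i x)\<^sup>2)"
  shows "integrable M (\<lambda>x. (\<Sum>i\<in>I. f i x)\<^sup>2)"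
  using assms
proof (induction I rule: finite_induct)
  case (insert i I)
  then show ?case
    by (simp add: square_integrable_add borel_measurable_sum)
qed simp

lemma integral_double_sum:
  fixes f :: "'i \<Rightarrow> 'j \<Rightarrow> 'a \<Rightarrow> real"
  assumes "\<And>i j. i \<in> I \<Longrightarrow> j \<in> J \<Longrightarrow> integrable M (f i j)"
  shows "(\<integral>x. (\<Sum>i\<in>I. \<Sum>j\<in>J. f i j x) \<partial>M) = (\<Sum>i\<in>I. \<Sum>j\<in>J. \<integral>x. f i j x \<partial>M)"
proof -
  have "(\<integral>x. (\<Sum>i\<in>I. \<Sum>j\<in>J. f i j x) \<partial>M) = (\<Sum>i\<in>I. \<integral>x. (\<Sum>j\<in>J. f i j x) \<partial>M)"
    using assms by (intro Bochner_Integration.integral_sum Bochner_Integration.integrable_sum)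
  also have "\<dots> = (\<Sum>i\<in>I. \<Sum>j\<in>J. \<integral>x. f i j x \<partial>M)"
    using assms by (intro sum.cong refl Bochner_Integration.integral_sum)
  finally show ?thesis .
qed

text \<open>The grouping lets an expectation split over each pair \<open>(j, l)\<close> when the
  \<open>a\<close> factors are deterministic or independent of the \<open>b\<close> factors.\<close>

lemma square_sum_mult:
  fixes a b :: "'i \<Rightarrow> 'a :: comm_semiring_1"
  shows "(\<Sum>j\<in>I. a j * b j)\<^sup>2 = (\<Sum>j\<in>I. \<Sum>l\<in>I. (a j * a l) * (b j * b l))"
  unfolding power2_eq_square sum_product by (simp add: mult_ac)

section \<open>Orthogonality of increments with respect to the past\<close>

context prob_space
begin

text \<open>Centering never increases a second moment, so raw Gaussian moments serve as bounds for
  the centered row quantities.\<close>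

lemma second_moment_centered_le:
  fixes X :: "'a \<Rightarrow> real"
  assumes "random_variable borel X" "integrable M (\<lambda>\<omega>. (X \<omega>)\<^sup>2)"
  shows "integrable M (\<lambda>\<omega>. (X \<omega> - expectation X)\<^sup>2)"
    "variance X \<le> expectation (\<lambda>\<omega>. (X \<omega>)\<^sup>2)"
proof -
  have X: "integrable M X"
    using assms by (rule square_integrable_imp_integrable)
  show "variance X \<le> expectation (\<lambda>\<omega>. (X \<omega>)\<^sup>2)"
    using variance_eq[OF X assms(2)] by simp
  show "integrable M (\<lambda>\<omega>. (X \<omega> - expectation X)\<^sup>2)"
    using square_integrable_add[of X M "\<lambda>_. - expectation X"] assms by simp
qed

text \<open>The index blocks \<open>{..<k}\<close> and \<open>{k}\<close> are disjoint, so the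
  restrictions of the family to them are independent. The function \<open>g\<close> receives the
  whole past as one argument, so it may be any functional of it, such as a product of partial
  sums.\<close>

lemma indep_vars_past:
  fixes V :: "nat \<Rightarrow> 'a \<Rightarrow> 'b" and g :: "(nat \<Rightarrow> 'b) \<Rightarrow> real" and h :: "'b \<Rightarrow> real"
  assumes ind: "indep_vars (\<lambda>_. N) V {..<n}" and k: "k < n"
    and g: "g \<in> borel_measurable (PiM {..<k} (\<lambda>_. N))" and h: "h \<in> borel_measurable N"
    and ig: "integrable M (\<lambda>\<omega>. g (\<lambda>i\<in>{..<k}. V i \<omega>))" and ih: "integrable M (\<lambda>\<omega>. h (V k \<omega>))"
  shows indep_vars_past_integrable: "integrable M (\<lambda>\<omega>. g (\<lambda>i\<in>{..<k}. V i \<omega>) * h (V k \<omega>))"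
    and indep_vars_past_expectation: "expectation (\<lambda>\<omega>. g (\<lambda>i\<in>{..<k}. V i \<omega>) * h (V k \<omega>)) =
      expectation (\<lambda>\<omega>. g (\<lambda>i\<in>{..<k}. V i \<omega>)) * expectation (\<lambda>\<omega>. h (V k \<omega>))"
proof -
  have h': "(\<lambda>f. h (f k)) \<in> borel_measurable (PiM {k} (\<lambda>_. N))"
    using h by measurable
  have "indep_var borel (g \<circ> (\<lambda>\<omega>. \<lambda>i\<in>{..<k}. V i \<omega>)) borel ((\<lambda>f. h (f k)) \<circ> (\<lambda>\<omega>. \<lambda>i\<in>{k}. V i \<omega>))"
    using k by (intro indep_var_compose[OF indep_var_restrict[OF ind] g h']) auto
  then have iv: "indep_var borel (\<lambda>\<omega>. g (\<lambda>i\<in>{..<k}. V i \<omega>)) borel (\<lambda>\<omega>. h (V k \<omega>))"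
    by (simp add: comp_def)
  show "integrable M (\<lambda>\<omega>. g (\<lambda>i\<in>{..<k}. V i \<omega>) * h (V k \<omega>))"
    by (rule indep_var_integrable[OF iv ig ih])
  show "expectation (\<lambda>\<omega>. g (\<lambda>i\<in>{..<k}. V i \<omega>) * h (V k \<omega>)) =
      expectation (\<lambda>\<omega>. g (\<lambda>i\<in>{..<k}. V i \<omega>)) * expectation (\<lambda>\<omega>. h (V k \<omega>))"
    by (rule indep_var_lebesgue_integral[OF iv ig ih])
qed

text \<open>The partial sum is a functional of the past and \<open>Q k\<close> is centered, so the
  cross term vanishes and each step adds at most \<open>L\<close>.\<close>

lemma second_moment_indep_sum_le:
  fixes Q :: "nat \<Rightarrow> 'a \<Rightarrow> real"
  assumes ind: "indep_vars (\<lambda>_. borel) Q {..<n}"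
    and Q2: "\<And>i. i < n \<Longrightarrow> integrable M (\<lambda>\<omega>. (Q i \<omega>)\<^sup>2)"
    and Q0: "\<And>i. i < n \<Longrightarrow> expectation (Q i) = 0"
    and L: "\<And>i. i < n \<Longrightarrow> expectation (\<lambda>\<omega>. (Q i \<omega>)\<^sup>2) \<le> L"
  shows "k \<le> n \<Longrightarrow> expectation (\<lambda>\<omega>. (\<Sum>i<k. Q i \<omega>)\<^sup>2) \<le> real k * L"
proof (induction k)
  case (Suc k)
  have rv: "i < n \<Longrightarrow> random_variable borel (Q i)" for i
    using ind by (auto simp: indep_vars_def)
  have S2: "integrable M (\<lambda>\<omega>. (\<Sum>i<k. Q i \<omega>)\<^sup>2)"
    using Suc.prems by (intro square_integrable_sum rv Q2) auto
  have Q1: "i < n \<Longrightarrow> integrable M (Q i)" for i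
    by (rule square_integrable_imp_integrable[OF rv Q2])
  have S1: "integrable M (\<lambda>\<omega>. \<Sum>i<k. Q i \<omega>)" and Qk: "integrable M (Q k)"
    using Suc.prems Q1 by auto
  have g: "(\<lambda>f. \<Sum>i<k. f i) \<in> borel_measurable (PiM {..<k} (\<lambda>_. borel :: real measure))"
    by measurable
  have kn: "k < n"
    using Suc.prems by simp
  note past = indep_vars_past[OF ind kn g, of "\<lambda>x. x"]
  have cross: "integrable M (\<lambda>\<omega>. (\<Sum>i<k. Q i \<omega>) * Q k \<omega>)"
    "expectation (\<lambda>\<omega>. (\<Sum>i<k. Q i \<omega>) * Q k \<omega>) = 0"
    using past S1 Qk Q0[OF kn] by simp_all
  have "expectation (\<lambda>\<omega>. (\<Sum>i<Suc k. Q i \<omega>)\<^sup>2) =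
      expectation (\<lambda>\<omega>. (\<Sum>i<k. Q i \<omega>)\<^sup>2 + (Q k \<omega>)\<^sup>2 + 2 * ((\<Sum>i<k. Q i \<omega>) * Q k \<omega>))"
    by (simp add: power2_sum mult.assoc)
  also have "\<dots> = expectation (\<lambda>\<omega>. (\<Sum>i<k. Q i \<omega>)\<^sup>2) + expectation (\<lambda>\<omega>. (Q k \<omega>)\<^sup>2)"
    using S2 Q2[OF kn] cross by simp
  also have "\<dots> \<le> real (Suc k) * L"
    using Suc.IH L[OF kn] kn by (simp add: algebra_simps)
  finally show ?case .
qed simp

text \<open>Given the past, \<open>D m\<close> is a linear form in the centered vector \<open>V m\<close>, so these are martingale
  differences and their second moments add up.\<close>

lemma second_moment_degenerate_sum:
  fixes V :: "nat \<Rightarrow> 'a \<Rightarrow> nat \<Rightarrow> real" and p :: nat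
  defines "D \<equiv> \<lambda>m (f :: nat \<Rightarrow> nat \<Rightarrow> real). \<Sum>j<p. (\<Sum>i<m. f i j) * f m j"
  assumes ind: "indep_vars (\<lambda>_. PiM {..<p} (\<lambda>_. borel)) V {..<n}"
    and V2: "\<And>i j. i < n \<Longrightarrow> j < p \<Longrightarrow> integrable M (\<lambda>\<omega>. (V i \<omega> j)\<^sup>2)"
    and V0: "\<And>i j. i < n \<Longrightarrow> j < p \<Longrightarrow> expectation (\<lambda>\<omega>. V i \<omega> j) = 0"
    and K: "\<And>i v. i < n \<Longrightarrow> expectation (\<lambda>\<omega>. (\<Sum>j<p. v j * V i \<omega> j)\<^sup>2) \<le> K * (\<Sum>j<p. (v j)\<^sup>2)"
  shows "k \<le> n \<Longrightarrow> integrable M (\<lambda>\<omega>. (\<Sum>m<k. D m (\<lambda>i. V i \<omega>))\<^sup>2) \<and>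
     expectation (\<lambda>\<omega>. (\<Sum>m<k. D m (\<lambda>i. V i \<omega>))\<^sup>2) \<le> (real k)\<^sup>2 * (real p * K\<^sup>2)"
proof (induction k)
  case (Suc k)
  let ?N = "PiM {..<p} (\<lambda>_. borel) :: (nat \<Rightarrow> real) measure"
  let ?S = "\<lambda>j \<omega>. \<Sum>i<k. V i \<omega> j" and ?F = "\<lambda>\<omega>. \<Sum>m<k. D m (\<lambda>i. V i \<omega>)"
  have kn: "k < n"
    using Suc.prems by simp
  have rv: "i < n \<Longrightarrow> random_variable ?N (V i)" for i
    using ind by (auto simp: indep_vars_def)
  have Vm: "random_variable borel (\<lambda>\<omega>. V i \<omega> j)" if "i < n" "j < p" for i j
    using measurable_compose[OF rv[OF that(1)] measurable_component_singleton[of j]] that(2) by simp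
  have Sm: "j < p \<Longrightarrow> random_variable borel (?S j)" for j
    using kn by (intro borel_measurable_sum Vm) auto
  have Fm: "random_variable borel ?F"
    unfolding D_def using kn by (intro borel_measurable_sum borel_measurable_times Vm) auto
  have S2: "j < p \<Longrightarrow> integrable M (\<lambda>\<omega>. (?S j \<omega>)\<^sup>2)" for j
    using kn by (intro square_integrable_sum Vm V2) auto
  have F2: "integrable M (\<lambda>\<omega>. (?F \<omega>)\<^sup>2)"
    and FE: "expectation (\<lambda>\<omega>. (?F \<omega>)\<^sup>2) \<le> (real k)\<^sup>2 * (real p * K\<^sup>2)"
    using Suc by auto
  have V1: "j < p \<Longrightarrow> integrable M (\<lambda>\<omega>. V k \<omega> j)" for j
    by (rule square_integrable_imp_integrable[OF Vm[OF kn] V2[OF kn]])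
  \<comment> \<open>The bound on linear forms, tested on a unit vector, controls a single
    coordinate.\<close>
  have K1: "expectation (\<lambda>\<omega>. (V i \<omega> j)\<^sup>2) \<le> K" if "i < n" "j < p" for i j
  proof -
    have 1: "(\<Sum>l<p. (if l = j then 1 else 0) * V i \<omega> l) = V i \<omega> j" for \<omega>
      using that(2) by (subst sum.remove[of _ j]) auto
    have 2: "(\<Sum>l<p. (if l = j then 1 else 0 :: real)\<^sup>2) = 1"
      using that(2) by (subst sum.remove[of _ j]) auto
    show ?thesis
      using K[OF that(1), of "\<lambda>l. if l = j then 1 else 0"] by (simp only: 1 2 mult_1_right)
  qed
  have SE: "expectation (\<lambda>\<omega>. (?S j \<omega>)\<^sup>2) \<le> real k * K" if j: "j < p" for j
  proof (rule second_moment_indep_sum_le[where n = n])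
    show "indep_vars (\<lambda>_. borel) (\<lambda>i \<omega>. V i \<omega> j) {..<n}"
      using j by (intro indep_vars_compose2[OF ind, where Y = "\<lambda>_ f. f j"]) measurable
  qed (use j V2 V0 K1 kn in auto)
  have comp [measurable]: "(\<lambda>f. f i j) \<in> borel_measurable (PiM {..<k} (\<lambda>_. ?N))" if "i < k" "j < p" for i j
    using measurable_compose[OF measurable_component_singleton[of i "{..<k}" "\<lambda>_. ?N"]
        measurable_component_singleton[of j]] that by simp
  have hm [measurable]: "(\<lambda>x. x j) \<in> borel_measurable ?N" if "j < p" for j
    using that by simp
  \<comment> \<open>The factor \<open>?F * ?S j\<close> depends only on the vectors before index
    \<open>k\<close>, so the centered factor makes the expectation vanish.\<close>
  have cross: "integrable M (\<lambda>\<omega>. (?F \<omega> * ?S j \<omega>) * V k \<omega> j) \<and>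
      expectation (\<lambda>\<omega>. (?F \<omega> * ?S j \<omega>) * V k \<omega> j) = 0" if j: "j < p" for j
  proof -
    let ?g = "\<lambda>f. (\<Sum>m<k. D m f) * (\<Sum>i<k. f i j)"
    have g: "?g \<in> borel_measurable (PiM {..<k} (\<lambda>_. ?N))"
      unfolding D_def using j
      by (intro borel_measurable_times borel_measurable_sum comp) auto
    have eq: "(\<Sum>m<k. D m (\<lambda>i\<in>{..<k}. V i \<omega>)) = ?F \<omega>" for \<omega>
      unfolding D_def by (intro sum.cong refl) auto
    have "integrable M (\<lambda>\<omega>. ?F \<omega> * ?S j \<omega>)"
      by (rule integrable_mult_of_square_integrable[OF Fm Sm[OF j] F2 S2[OF j]])
    then show ?thesis
      using indep_vars_past[OF ind kn g hm[OF j]] V1[OF j] V0[OF kn j] by (simp add: eq)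
  qed
  have VV: "integrable M (\<lambda>\<omega>. V k \<omega> j * V k \<omega> l)" if "j < p" "l < p" for j l
    using that kn by (intro integrable_mult_of_square_integrable Vm V2) auto
  have SS: "integrable M (\<lambda>\<omega>. ?S j \<omega> * ?S l \<omega>)" if "j < p" "l < p" for j l
    using that by (intro integrable_mult_of_square_integrable Sm S2)
  have quad: "integrable M (\<lambda>\<omega>. (?S j \<omega> * ?S l \<omega>) * (V k \<omega> j * V k \<omega> l)) \<and>
      expectation (\<lambda>\<omega>. (?S j \<omega> * ?S l \<omega>) * (V k \<omega> j * V k \<omega> l)) =
      expectation (\<lambda>\<omega>. ?S j \<omega> * ?S l \<omega>) * expectation (\<lambda>\<omega>. V k \<omega> j * V k \<omega> l)"
    if j: "j < p" and l: "l < p" for j l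
  proof -
    let ?g = "\<lambda>f :: nat \<Rightarrow> nat \<Rightarrow> real. (\<Sum>i<k. f i j) * (\<Sum>i<k. f i l)"
    have g: "?g \<in> borel_measurable (PiM {..<k} (\<lambda>_. ?N))"
      using that by (intro borel_measurable_times borel_measurable_sum comp) auto
    have h: "(\<lambda>x. x j * x l) \<in> borel_measurable ?N"
      using that by measurable
    have eq: "?g (\<lambda>i\<in>{..<k}. V i \<omega>) = ?S j \<omega> * ?S l \<omega>" for \<omega>
      by simp
    show ?thesis
      using indep_vars_past[OF ind kn g h] SS[OF that] VV[OF that] by (simp add: eq)
  qed
  have Dk: "(D k (\<lambda>i. V i \<omega>))\<^sup>2 = (\<Sum>j<p. \<Sum>l<p. (?S j \<omega> * ?S l \<omega>) * (V k \<omega> j * V k \<omega> l))" for \<omega>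
    unfolding D_def by (rule square_sum_mult)
  have Dk2: "integrable M (\<lambda>\<omega>. (D k (\<lambda>i. V i \<omega>))\<^sup>2)"
    unfolding Dk using quad by (intro Bochner_Integration.integrable_sum) auto
  let ?A = "\<lambda>j l. expectation (\<lambda>\<omega>. V k \<omega> j * V k \<omega> l)"
  \<comment> \<open>The numbers \<open>?A j l\<close> are the covariances of the coordinates of
    \<open>V k\<close>, and the hypothesis on linear forms bounds their quadratic form by
    \<open>K\<close>.\<close>
  have A: "(\<Sum>j<p. \<Sum>l<p. v j * v l * ?A j l) \<le> K * (\<Sum>j<p. (v j)\<^sup>2)" for v :: "nat \<Rightarrow> real"
  proof -
    have "(\<Sum>j<p. \<Sum>l<p. v j * v l * ?A j l) =
        expectation (\<lambda>\<omega>. \<Sum>j<p. \<Sum>l<p. v j * v l * (V k \<omega> j * V k \<omega> l))"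
      using VV by (subst integral_double_sum) auto
    also have "\<dots> = expectation (\<lambda>\<omega>. (\<Sum>j<p. v j * V k \<omega> j)\<^sup>2)"
      by (simp add: square_sum_mult)
    finally show ?thesis
      using K[OF kn] by simp
  qed
  have "expectation (\<lambda>\<omega>. (D k (\<lambda>i. V i \<omega>))\<^sup>2) =
      (\<Sum>j<p. \<Sum>l<p. expectation (\<lambda>\<omega>. ?S j \<omega> * ?S l \<omega>) * ?A j l)"
    unfolding Dk using quad by (subst integral_double_sum) auto
  \<comment> \<open>The constants \<open>?A j l\<close> return under the integral, where the
    quadratic form bound applies pointwise with \<open>v j = ?S j \<omega>\<close>.\<close>
  also have "\<dots> = expectation (\<lambda>\<omega>. \<Sum>j<p. \<Sum>l<p. ?S j \<omega> * ?S l \<omega> * ?A j l)"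
    using SS by (subst integral_double_sum) auto
  also have "\<dots> \<le> expectation (\<lambda>\<omega>. K * (\<Sum>j<p. (?S j \<omega>)\<^sup>2))"
    using SS S2 A by (intro integral_mono) (auto intro!: Bochner_Integration.integrable_sum)
  also have "\<dots> = K * (\<Sum>j<p. expectation (\<lambda>\<omega>. (?S j \<omega>)\<^sup>2))"
    using S2 by (simp add: Bochner_Integration.integral_sum)
  also have "\<dots> \<le> real k * (real p * K\<^sup>2)"
  \<comment> \<open>Nonnegativity of \<open>K\<close> is read off from coordinate 0, which exists
    only for positive \<open>p\<close>; for \<open>p = 0\<close> both sides are 0.\<close>
  proof (cases "p = 0")
    case False
    then have "0 \<le> K"
      using K1[OF kn, of 0] by (smt (verit) gr0I integral_nonneg_AE AE_I2 zero_le_power2)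
    then have "K * (\<Sum>j<p. expectation (\<lambda>\<omega>. (?S j \<omega>)\<^sup>2)) \<le> K * (\<Sum>j<p. real k * K)"
      using SE by (intro mult_left_mono sum_mono) auto
    then show ?thesis
      by (simp add: power2_eq_square mult_ac)
  qed simp
  finally have DE: "expectation (\<lambda>\<omega>. (D k (\<lambda>i. V i \<omega>))\<^sup>2) \<le> real k * (real p * K\<^sup>2)" .
  have FD: "?F \<omega> * D k (\<lambda>i. V i \<omega>) = (\<Sum>j<p. (?F \<omega> * ?S j \<omega>) * V k \<omega> j)" for \<omega>
  proof -
    have "D k (\<lambda>i. V i \<omega>) = (\<Sum>j<p. ?S j \<omega> * V k \<omega> j)"
      by (simp add: D_def)
    then show ?thesis
      unfolding mult.assoc by (simp only: sum_distrib_left[symmetric])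
  qed
  have FD0: "integrable M (\<lambda>\<omega>. ?F \<omega> * D k (\<lambda>i. V i \<omega>))"
    "expectation (\<lambda>\<omega>. ?F \<omega> * D k (\<lambda>i. V i \<omega>)) = 0"
    unfolding FD using cross by (auto simp: Bochner_Integration.integral_sum intro!: Bochner_Integration.integrable_sum)
  have split: "(\<Sum>m<Suc k. D m (\<lambda>i. V i \<omega>))\<^sup>2 =
      (?F \<omega>)\<^sup>2 + (D k (\<lambda>i. V i \<omega>))\<^sup>2 + 2 * (?F \<omega> * D k (\<lambda>i. V i \<omega>))" for \<omega>
    by (simp add: power2_sum mult.assoc)
  have "real k * (real p * K\<^sup>2) + (real k)\<^sup>2 * (real p * K\<^sup>2) \<le> (real (Suc k))\<^sup>2 * (real p * K\<^sup>2)"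
    unfolding distrib_right[symmetric]
  proof (rule mult_right_mono)
    show "real k + (real k)\<^sup>2 \<le> (real (Suc k))\<^sup>2"
      by (simp add: power2_eq_square algebra_simps)
  qed simp
  then show ?case
    unfolding split using F2 Dk2 FD0 FE DE by simp
qed simp

end

section \<open>Moments of Gaussian linear forms\<close>

text \<open>The index set is left general because there are two uses: one row of the Gaussian array
  including its noise entry, and the noise column alone.\<close>

locale std_gaussian_family = prob_space +
  fixes I :: "'i set" and x :: "'i \<Rightarrow> 'a \<Rightarrow> real"
  assumes finite_index: "finite I"
    and indep: "indep_vars (\<lambda>_. borel) x I"
    and std_normal: "\<And>j. j \<in> I \<Longrightarrow> distributed M lborel (x j) std_normal_density"
begin

definition lin :: "('i \<Rightarrow> real) \<Rightarrow> 'a \<Rightarrow> real" where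
  "lin v \<omega> = (\<Sum>j\<in>I. v j * x j \<omega>)"

definition dot :: "('i \<Rightarrow> real) \<Rightarrow> ('i \<Rightarrow> real) \<Rightarrow> real" where
  "dot u v = (\<Sum>j\<in>I. u j * v j)"

lemma dot_self_nonneg: "0 \<le> dot v v"
  unfolding dot_def by (intro sum_nonneg) simp

lemma lin_measurable [measurable]: "lin v \<in> borel_measurable M"
  unfolding lin_def[abs_def] using indep
  by (intro borel_measurable_sum borel_measurable_times) (auto simp: indep_vars_def)

lemma lin_add: "lin (\<lambda>j. u j + v j) \<omega> = lin u \<omega> + lin v \<omega>"
  by (simp add: lin_def algebra_simps sum.distrib)

lemma lin_diff: "lin (\<lambda>j. u j - v j) \<omega> = lin u \<omega> - lin v \<omega>"
  by (simp add: lin_def algebra_simps sum_subtractf)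

lemma dot_add: "dot (\<lambda>j. u j + v j) (\<lambda>j. u j + v j) = dot u u + dot v v + 2 * dot u v"
  by (simp add: dot_def algebra_simps sum.distrib sum_distrib_left)

lemma dot_diff: "dot (\<lambda>j. u j - v j) (\<lambda>j. u j - v j) = dot u u + dot v v - 2 * dot u v"
  by (simp add: dot_def algebra_simps sum.distrib sum_subtractf sum_distrib_left)

lemma dot_square_le: "(dot u v)\<^sup>2 \<le> dot u u * dot v v"
  using Cauchy_Schwarz_ineq_sum[of u v I] by (simp add: dot_def power2_eq_square)

text \<open>Sums of independent normal variables are normal with variances added. Each summand must
  have positive variance, so the sum is first restricted to the indices with
  \<open>v j \<noteq> 0\<close>.\<close>

lemma lin_distributed:
  assumes "0 < dot v v"
  shows "distributed M lborel (lin v) (normal_density 0 (sqrt (dot v v)))"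
proof -
  let ?J = "{j \<in> I. v j \<noteq> 0}"
  have ne: "?J \<noteq> {}"
  proof
    assume "?J = {}"
    then have "dot v v = 0"
      unfolding dot_def by (intro sum.neutral) auto
    then show False
      using assms by simp
  qed
  have "indep_vars (\<lambda>_. borel) (\<lambda>j \<omega>. v j * x j \<omega>) ?J"
    by (rule indep_vars_compose2[OF indep_vars_subset[OF indep], where Y = "\<lambda>j t. v j * t"]) auto
  moreover have "distributed M lborel (\<lambda>\<omega>. v j * x j \<omega>) (normal_density 0 \<bar>v j\<bar>)" if "j \<in> ?J" for j
    using normal_density_affine[OF std_normal[of j], of "v j" 0] that by simp
  ultimately have "distributed M lborel (\<lambda>\<omega>. \<Sum>j\<in>?J. v j * x j \<omega>)
      (normal_density (\<Sum>j\<in>?J. 0) (sqrt (\<Sum>j\<in>?J. \<bar>v j\<bar>\<^sup>2)))"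
    using ne finite_index by (intro sum_indep_normal) auto
  moreover have "(\<Sum>j\<in>?J. v j * x j \<omega>) = lin v \<omega>" for \<omega>
    unfolding lin_def using finite_index by (intro sum.mono_neutral_left) auto
  moreover have "(\<Sum>j\<in>?J. \<bar>v j\<bar>\<^sup>2) = dot v v"
    unfolding dot_def using finite_index
    by (simp add: power2_eq_square) (intro sum.mono_neutral_left, auto)
  ultimately show ?thesis
    by simp
qed

text \<open>The degenerate case, where there is no normal density: the form vanishes identically,
  and the moment formulas below hold trivially.\<close>

lemma lin_eq_0:
  assumes "\<not> 0 < dot v v"
  shows "lin v \<omega> = 0" "dot v v = 0"
proof -
  show 0: "dot v v = 0"
    using assms dot_self_nonneg[of v] by simp
  then have "\<forall>j\<in>I. v j * v j = 0"
    unfolding dot_def using finite_index by (subst (asm) sum_nonneg_eq_0_iff) auto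
  then show "lin v \<omega> = 0"
    by (simp add: lin_def)
qed

section \<open>Moments of one linear form\<close>

lemma lin_power_integrable: "integrable M (\<lambda>\<omega>. lin v \<omega> ^ k)"
proof (cases "0 < dot v v")
  case True
  then show ?thesis
    using distributed_integrable[OF lin_distributed[OF True], of "\<lambda>t. t ^ k"]
      integrable_normal_moment[of "sqrt (dot v v)" 0 k] by simp
next
  case False
  then show ?thesis
    by (simp add: lin_eq_0)
qed

text \<open>The factor is the double factorial \<open>(2k - 1)!!\<close>, that is 1, 3 and 105 for
  \<open>k\<close> equal to 1, 2 and 4.\<close>

lemma expectation_lin_even:
  "expectation (\<lambda>\<omega>. lin v \<omega> ^ (2 * k)) = fact (2 * k) / (2 ^ k * fact k) * dot v v ^ k"
proof (cases "0 < dot v v")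
  case True
  have "expectation (\<lambda>\<omega>. lin v \<omega> ^ (2 * k)) = fact (2 * k) / ((2 / dot v v) ^ k * fact k)"
    using distributed_integral[OF lin_distributed[OF True], of "\<lambda>t. t ^ (2 * k)"]
      integral_normal_moment_even[of "sqrt (dot v v)" 0 k] True by simp
  then show ?thesis
    using True by (simp add: power_divide)
next
  case False
  then show ?thesis
    by (cases "k = 0") (simp_all add: lin_eq_0 prob_space power_0_left)
qed

lemma expectation_lin_2: "expectation (\<lambda>\<omega>. (lin v \<omega>)\<^sup>2) = dot v v"
  using expectation_lin_even[of v 1] by simp

lemma expectation_lin_4: "expectation (\<lambda>\<omega>. lin v \<omega> ^ 4) = 3 * (dot v v)\<^sup>2"
  using expectation_lin_even[of v 2] by (simp add: fact_numeral)

lemma expectation_lin_8: "expectation (\<lambda>\<omega>. lin v \<omega> ^ 8) = 105 * dot v v ^ 4"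
  using expectation_lin_even[of v 4] by (simp add: fact_numeral)

section \<open>Mixed moments of two linear forms\<close>

lemma lin_mult_integrable: "integrable M (\<lambda>\<omega>. lin u \<omega> * lin v \<omega>)"
  by (intro integrable_mult_of_square_integrable lin_power_integrable) auto

text \<open>Polarisation reduces the covariance to second moments of the single forms
  \<open>lin u \<plusminus> lin v\<close>, so no joint density is involved.\<close>

lemma expectation_lin_mult: "expectation (\<lambda>\<omega>. lin u \<omega> * lin v \<omega>) = dot u v"
proof -
  have "lin u \<omega> * lin v \<omega> = (1 / 4) * ((lin (\<lambda>j. u j + v j) \<omega>)\<^sup>2 - (lin (\<lambda>j. u j - v j) \<omega>)\<^sup>2)" for \<omega>
    by (simp add: lin_add lin_diff power2_eq_square algebra_simps)
  then have "expectation (\<lambda>\<omega>. lin u \<omega> * lin v \<omega>) =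
     1 / 4 * (expectation (\<lambda>\<omega>. (lin (\<lambda>j. u j + v j) \<omega>)\<^sup>2) - expectation (\<lambda>\<omega>. (lin (\<lambda>j. u j - v j) \<omega>)\<^sup>2))"
    by (simp only: integral_mult_right_zero Bochner_Integration.integral_diff lin_power_integrable)
  then show ?thesis
    by (simp add: expectation_lin_2 dot_add dot_diff)
qed

lemma lin_mult_square_integrable: "integrable M (\<lambda>\<omega>. (lin u \<omega> * lin v \<omega>)\<^sup>2)"
proof -
  have "integrable M (\<lambda>\<omega>. (lin u \<omega>)\<^sup>2 * (lin v \<omega>)\<^sup>2)"
    using lin_power_integrable[of _ 4]
    by (intro integrable_mult_of_square_integrable) auto
  then show ?thesis
    by (simp add: power_mult_distrib)
qed

text \<open>Isserlis' formula, obtained from the fourth moments of \<open>lin u \<plusminus> lin v\<close> by polarisation.\<close>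

lemma expectation_lin_mult_square:
  "expectation (\<lambda>\<omega>. (lin u \<omega> * lin v \<omega>)\<^sup>2) = dot u u * dot v v + 2 * (dot u v)\<^sup>2"
proof -
  have eq: "(\<lambda>\<omega>. (lin u \<omega> * lin v \<omega>)\<^sup>2) =
      (\<lambda>\<omega>. 1 / 12 * (lin (\<lambda>j. u j + v j) \<omega> ^ 4 + lin (\<lambda>j. u j - v j) \<omega> ^ 4 - 2 * lin u \<omega> ^ 4 - 2 * lin v \<omega> ^ 4))"
    unfolding lin_add lin_diff by (simp add: eval_nat_numeral algebra_simps)
  have "expectation (\<lambda>\<omega>. (lin u \<omega> * lin v \<omega>)\<^sup>2) =
      1 / 12 * (3 * (dot u u + dot v v + 2 * dot u v)\<^sup>2 + 3 * (dot u u + dot v v - 2 * dot u v)\<^sup>2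
        - 2 * (3 * (dot u u)\<^sup>2) - 2 * (3 * (dot v v)\<^sup>2))"
    unfolding eq by (simp add: lin_power_integrable expectation_lin_4 dot_add dot_diff)
  then show ?thesis
    by (simp add: power2_eq_square algebra_simps)
qed

text \<open>Cauchy-Schwarz absorbs the term with \<open>dot u v\<close> in Isserlis' formula, which
  turns the factor 1 into 3.\<close>

lemma expectation_lin_mult_square_le:
  "expectation (\<lambda>\<omega>. (lin u \<omega> * lin v \<omega>)\<^sup>2) \<le> 3 * dot u u * dot v v"
  using dot_square_le[of u v] by (simp add: expectation_lin_mult_square)

text \<open>The inequality \<open>2 a^4 b^4 \<le> a^8 + b^8\<close> reduces the mixed moment to
  eighth moments; 105 is the eighth moment of a standard normal variable.\<close>

lemma lin_mult_fourth:
  shows lin_mult_fourth_integrable: "integrable M (\<lambda>\<omega>. (lin u \<omega> * lin v \<omega>) ^ 4)"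
    and expectation_lin_mult_fourth_le:
      "expectation (\<lambda>\<omega>. (lin u \<omega> * lin v \<omega>) ^ 4) \<le> 105 / 2 * (dot u u ^ 4 + dot v v ^ 4)"
proof -
  have "integrable M (\<lambda>\<omega>. lin u \<omega> ^ 4 * lin v \<omega> ^ 4)"
    using lin_power_integrable[of _ 8]
    by (intro integrable_mult_of_square_integrable) (auto simp flip: power_mult)
  then show int: "integrable M (\<lambda>\<omega>. (lin u \<omega> * lin v \<omega>) ^ 4)"
    by (simp add: power_mult_distrib)
  have "expectation (\<lambda>\<omega>. (lin u \<omega> * lin v \<omega>) ^ 4) \<le> expectation (\<lambda>\<omega>. 1 / 2 * (lin u \<omega> ^ 8 + lin v \<omega> ^ 8))"
  proof (rule integral_mono[OF int])
    fix \<omega>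
    show "(lin u \<omega> * lin v \<omega>) ^ 4 \<le> 1 / 2 * (lin u \<omega> ^ 8 + lin v \<omega> ^ 8)"
      using zero_le_power2[of "lin u \<omega> ^ 4 - lin v \<omega> ^ 4"]
      by (simp add: power2_diff power_mult_distrib flip: power_mult)
  qed (simp add: lin_power_integrable)
  also have "\<dots> = 105 / 2 * (dot u u ^ 4 + dot v v ^ 4)"
    by (simp add: lin_power_integrable expectation_lin_8)
  finally show "expectation (\<lambda>\<omega>. (lin u \<omega> * lin v \<omega>) ^ 4) \<le> 105 / 2 * (dot u u ^ 4 + dot v v ^ 4)" .
qed

end

section \<open>Decomposition of the estimator\<close>

text \<open>Index \<open>p\<close> is the noise entry of a row, and the indices below
  \<open>p\<close> are its covariates. With \<open>\<gamma> j = \<beta> j\<close> for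
  \<open>j < p\<close> and \<open>\<gamma> p\<close> the noise standard deviation,
  \<open>lin \<gamma>\<close> is the response.\<close>

locale gaussian_row = std_gaussian_family M "{..<Suc p}" x
  for M :: "'a measure" and p :: nat and x :: "nat \<Rightarrow> 'a \<Rightarrow> real"
begin

text \<open>Coefficient 0 at the noise index makes \<open>lin (pad v)\<close> a form in the
  covariates alone.\<close>

abbreviation pad :: "(nat \<Rightarrow> real) \<Rightarrow> nat \<Rightarrow> real" where
  "pad v j \<equiv> if j < p then v j else 0"

abbreviation unit :: "nat \<Rightarrow> nat \<Rightarrow> real" where
  "unit j l \<equiv> if l = j then 1 else 0"

lemma lin_pad: "lin (pad v) \<omega> = (\<Sum>j<p. v j * x j \<omega>)"
  by (simp add: lin_def cong: sum.cong_simp)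

lemma dot_pad: "dot u (pad v) = (\<Sum>j<p. u j * v j)"
  by (simp add: dot_def cong: sum.cong_simp)

lemma dot_pad_pad: "dot (pad v) (pad v) = sqnorm p v"
  by (simp add: dot_def sqnorm_def power2_eq_square cong: sum.cong_simp)

lemma lin_unit: "j < Suc p \<Longrightarrow> lin (unit j) \<omega> = x j \<omega>"
  unfolding lin_def by (subst sum.remove[of _ j]) auto

lemma dot_unit: "j < Suc p \<Longrightarrow> dot u (unit j) = u j"
  unfolding dot_def by (subst sum.remove[of _ j]) auto

lemma dot_Suc: "dot \<gamma> \<gamma> = sqnorm p \<gamma> + (\<gamma> p)\<^sup>2"
  by (simp add: dot_def sqnorm_def power2_eq_square)

lemma expectation_response_mult:
  assumes "j < p"
  shows "expectation (\<lambda>\<omega>. x j \<omega> * lin \<gamma> \<omega>) = \<gamma> j"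
  using expectation_lin_mult[of \<gamma> "unit j"] assms by (simp add: lin_unit dot_unit mult.commute)

text \<open>A linear combination of the coordinates of \<open>w\<close> is a product of two linear
  forms minus its mean, so the bound from Isserlis' formula applies. The factor
  \<open>3 * dot \<gamma> \<gamma>\<close> becomes the constant \<open>K\<close> of
  \<open>second_moment_degenerate_sum\<close>.\<close>

lemma centered_product_bounds:
  fixes \<gamma> :: "nat \<Rightarrow> real"
  defines "w \<equiv> \<lambda>\<omega> j. x j \<omega> * lin \<gamma> \<omega> - \<gamma> j"
  shows "j < p \<Longrightarrow> integrable M (\<lambda>\<omega>. (w \<omega> j)\<^sup>2)"
    "j < p \<Longrightarrow> expectation (\<lambda>\<omega>. w \<omega> j) = 0"
    "expectation (\<lambda>\<omega>. (\<Sum>j<p. v j * w \<omega> j)\<^sup>2) \<le> 3 * dot \<gamma> \<gamma> * (\<Sum>j<p. (v j)\<^sup>2)"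
proof -
  {
    assume j: "j < p"
    have eq: "w \<omega> j = lin \<gamma> \<omega> * lin (unit j) \<omega> - expectation (\<lambda>\<omega>. lin \<gamma> \<omega> * lin (unit j) \<omega>)" for \<omega>
      using j expectation_response_mult[OF j, of \<gamma>] by (simp add: w_def lin_unit mult.commute)
    show "integrable M (\<lambda>\<omega>. (w \<omega> j)\<^sup>2)"
      unfolding eq by (intro second_moment_centered_le lin_mult_square_integrable) auto
    show "expectation (\<lambda>\<omega>. w \<omega> j) = 0"
      unfolding eq by (simp add: lin_mult_integrable prob_space)
  }
  have eq: "(\<Sum>j<p. v j * w \<omega> j) =
      lin \<gamma> \<omega> * lin (pad v) \<omega> - expectation (\<lambda>\<omega>. lin \<gamma> \<omega> * lin (pad v) \<omega>)" for \<omega>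
    unfolding expectation_lin_mult unfolding lin_pad dot_pad
    by (simp add: w_def sum_distrib_left sum_subtractf algebra_simps)
  have "expectation (\<lambda>\<omega>. (\<Sum>j<p. v j * w \<omega> j)\<^sup>2) \<le> expectation (\<lambda>\<omega>. (lin \<gamma> \<omega> * lin (pad v) \<omega>)\<^sup>2)"
    unfolding eq by (intro second_moment_centered_le lin_mult_square_integrable) auto
  also have "\<dots> \<le> 3 * dot \<gamma> \<gamma> * dot (pad v) (pad v)"
    by (rule expectation_lin_mult_square_le)
  finally show "expectation (\<lambda>\<omega>. (\<Sum>j<p. v j * w \<omega> j)\<^sup>2) \<le> 3 * dot \<gamma> \<gamma> * (\<Sum>j<p. (v j)\<^sup>2)"
    by (simp add: dot_pad_pad sqnorm_def)
qed

text \<open>\<open>A\<close> is the contribution of one row to \<open>n (n + 1)\<close> times the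
  estimator once the U-statistic is split off, up to an additive constant, and \<open>\<mu>\<close>
  is its mean. Its three terms are bounded separately; the total is of order \<open>n^2\<close> if
  \<open>p\<close> is at most of order \<open>n\<close> and the coefficients stay bounded.\<close>

lemma row_statistic_bounds:
  fixes n :: nat and \<gamma> :: "nat \<Rightarrow> real"
  assumes n: "0 < n"
  defines "A \<equiv> \<lambda>\<omega>. (real p + real n + 1) * (lin \<gamma> \<omega>)\<^sup>2 - (\<Sum>j<p. (x j \<omega> * lin \<gamma> \<omega>)\<^sup>2)
      - 2 * (real n - 1) * (\<Sum>j<p. \<gamma> j * (x j \<omega> * lin \<gamma> \<omega>))"
    and "\<mu> \<equiv> (real n + 1) * dot \<gamma> \<gamma> - 2 * real n * sqnorm p \<gamma>"
  shows "integrable M (\<lambda>\<omega>. (A \<omega> - \<mu>)\<^sup>2)" "expectation (\<lambda>\<omega>. A \<omega> - \<mu>) = 0"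
    "expectation (\<lambda>\<omega>. (A \<omega> - \<mu>)\<^sup>2) \<le> 3 * ((real p + real n + 1)\<^sup>2 * (3 * (dot \<gamma> \<gamma>)\<^sup>2)
       + (real p)\<^sup>2 * (105 / 2 * (dot \<gamma> \<gamma> ^ 4 + 1)) + 4 * (real n)\<^sup>2 * (3 * dot \<gamma> \<gamma> * sqnorm p \<gamma>))"
proof -
  let ?u = "\<lambda>\<omega>. (real p + real n + 1) * (lin \<gamma> \<omega>)\<^sup>2"
  let ?v = "\<lambda>\<omega>. \<Sum>j<p. (lin \<gamma> \<omega> * lin (unit j) \<omega>)\<^sup>2"
  let ?w = "\<lambda>\<omega>. 2 * (real n - 1) * (lin \<gamma> \<omega> * lin (pad \<gamma>) \<omega>)"
  have A: "A \<omega> = ?u \<omega> - ?v \<omega> - ?w \<omega>" for \<omega>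
    by (simp add: A_def lin_pad lin_unit sum_distrib_left mult_ac cong: sum.cong_simp)
  have u2: "integrable M (\<lambda>\<omega>. (?u \<omega>)\<^sup>2)"
    using lin_power_integrable[of \<gamma> 4] by (simp add: power_mult_distrib flip: power_mult)
  have v2: "integrable M (\<lambda>\<omega>. (?v \<omega>)\<^sup>2)"
    using lin_mult_fourth_integrable[of \<gamma>]
    by (intro square_integrable_sum) (auto simp flip: power_mult)
  have w2: "integrable M (\<lambda>\<omega>. (?w \<omega>)\<^sup>2)"
    using lin_mult_square_integrable[of \<gamma> "pad \<gamma>"] by (simp add: power_mult_distrib)
  have Am: "A \<in> borel_measurable M"
    unfolding A[abs_def] by measurable
  have uv: "integrable M (\<lambda>\<omega>. (?u \<omega> + - ?v \<omega>)\<^sup>2)"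
    using u2 v2 by (intro square_integrable_add) auto
  have "integrable M (\<lambda>\<omega>. (?u \<omega> + - ?v \<omega> + - ?w \<omega>)\<^sup>2)"
    using w2 by (intro square_integrable_add[OF _ _ uv]) auto
  then have A2: "integrable M (\<lambda>\<omega>. (A \<omega>)\<^sup>2)"
    by (simp add: A)
  \<comment> \<open>Isserlis' formula with \<open>unit j\<close>, which has squared norm 1.\<close>
  have vE: "expectation ?v = (\<Sum>j<p. dot \<gamma> \<gamma> + 2 * (\<gamma> j)\<^sup>2)"
    by (subst Bochner_Integration.integral_sum)
      (auto simp: lin_mult_square_integrable expectation_lin_mult_square dot_unit intro!: sum.cong)
  have "expectation A = expectation ?u - expectation ?v - expectation ?w"
    unfolding A[abs_def] using lin_power_integrable[of \<gamma> 2]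
    by (simp add: lin_mult_square_integrable lin_mult_integrable)
  \<comment> \<open>With \<open>t = dot \<gamma> \<gamma>\<close> and
    \<open>b = sqnorm p \<gamma>\<close> the means combine as \<open>(p + n + 1) t - (p t + 2 b) - 2
    (n - 1) b = (n + 1) t - 2 n b\<close>: the part of order \<open>p\<close> cancels.\<close>
  also have "\<dots> = \<mu>"
  proof -
    have uE: "expectation ?u = (real p + real n + 1) * dot \<gamma> \<gamma>"
      by (simp add: expectation_lin_2)
    have "expectation ?w = 2 * (real n - 1) * (\<Sum>j<p. \<gamma> j * \<gamma> j)"
      by (simp only: integral_mult_right_zero expectation_lin_mult dot_pad)
    then have wE: "expectation ?w = 2 * (real n - 1) * sqnorm p \<gamma>"
      by (simp only: sqnorm_def power2_eq_square)
    have "expectation ?v = real p * dot \<gamma> \<gamma> + 2 * sqnorm p \<gamma>"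
      by (simp add: vE sqnorm_def sum.distrib flip: sum_distrib_left)
    then show ?thesis
      unfolding uE wE by (simp add: \<mu>_def algebra_simps)
  qed
  finally have AE: "expectation A = \<mu>" .
  show "integrable M (\<lambda>\<omega>. (A \<omega> - \<mu>)\<^sup>2)"
    using second_moment_centered_le(1)[OF Am A2] by (simp add: AE)
  show "expectation (\<lambda>\<omega>. A \<omega> - \<mu>) = 0"
    using square_integrable_imp_integrable[OF Am A2] by (simp add: AE prob_space)
  \<comment> \<open>Cauchy-Schwarz over the \<open>p\<close> coordinates costs one factor
    \<open>p\<close>; summing the fourth moments gives the other.\<close>
  have v_le: "(?v \<omega>)\<^sup>2 \<le> real p * (\<Sum>j<p. (lin \<gamma> \<omega> * lin (unit j) \<omega>) ^ 4)" for \<omega>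
    using sum_squared_le_sum_of_squares[of "\<lambda>j. (lin \<gamma> \<omega> * lin (unit j) \<omega>)\<^sup>2" "{..<p}"]
    by (simp add: mult.commute flip: power_mult)
  have v_int: "integrable M (\<lambda>\<omega>. real p * (\<Sum>j<p. (lin \<gamma> \<omega> * lin (unit j) \<omega>) ^ 4))"
    by (simp add: lin_mult_fourth_integrable)
  have "expectation (\<lambda>\<omega>. (?v \<omega>)\<^sup>2) \<le> expectation (\<lambda>\<omega>. real p * (\<Sum>j<p. (lin \<gamma> \<omega> * lin (unit j) \<omega>) ^ 4))"
    by (rule integral_mono[OF v2 v_int v_le])
  also have "\<dots> = real p * (\<Sum>j<p. expectation (\<lambda>\<omega>. (lin \<gamma> \<omega> * lin (unit j) \<omega>) ^ 4))"
    by (simp add: lin_mult_fourth_integrable)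
  also have "\<dots> \<le> real p * (\<Sum>j<p. 105 / 2 * (dot \<gamma> \<gamma> ^ 4 + 1))"
  proof (intro mult_left_mono sum_mono)
    fix j assume "j \<in> {..<p}"
    then show "expectation (\<lambda>\<omega>. (lin \<gamma> \<omega> * lin (unit j) \<omega>) ^ 4) \<le> 105 / 2 * (dot \<gamma> \<gamma> ^ 4 + 1)"
      using expectation_lin_mult_fourth_le[of \<gamma> "unit j"] dot_unit[of j "unit j"] by simp
  qed simp
  finally have v_bound: "expectation (\<lambda>\<omega>. (?v \<omega>)\<^sup>2) \<le> (real p)\<^sup>2 * (105 / 2 * (dot \<gamma> \<gamma> ^ 4 + 1))"
    by (simp add: power2_eq_square)
  have u_bound: "expectation (\<lambda>\<omega>. (?u \<omega>)\<^sup>2) = (real p + real n + 1)\<^sup>2 * (3 * (dot \<gamma> \<gamma>)\<^sup>2)"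
    using expectation_lin_4[of \<gamma>] by (simp add: power_mult_distrib flip: power_mult)
  have "expectation (\<lambda>\<omega>. (?w \<omega>)\<^sup>2) = (2 * (real n - 1))\<^sup>2 * expectation (\<lambda>\<omega>. (lin \<gamma> \<omega> * lin (pad \<gamma>) \<omega>)\<^sup>2)"
    by (simp only: power_mult_distrib[of "2 * (real n - 1)"] integral_mult_right_zero)
  \<comment> \<open>Positivity of \<open>n\<close> makes \<open>n - 1\<close> nonnegative, so that
    squaring is monotone here.\<close>
  also have "\<dots> \<le> (2 * real n)\<^sup>2 * (3 * dot \<gamma> \<gamma> * dot (pad \<gamma>) (pad \<gamma>))"
    using n by (intro mult_mono power_mono expectation_lin_mult_square_le) auto
  finally have w_bound: "expectation (\<lambda>\<omega>. (?w \<omega>)\<^sup>2) \<le> 4 * (real n)\<^sup>2 * (3 * dot \<gamma> \<gamma> * sqnorm p \<gamma>)"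
    by (simp add: dot_pad_pad power_mult_distrib)
  \<comment> \<open>The difference of the two sides is exactly the sum of the three squares
    supplied.\<close>
  have sq3: "(a - b - c)\<^sup>2 \<le> 3 * (a\<^sup>2 + b\<^sup>2 + c\<^sup>2)" for a b c :: real
    using zero_le_power2[of "a + b"] zero_le_power2[of "a + c"] zero_le_power2[of "b - c"]
    by (simp add: power2_eq_square algebra_simps)
  have "expectation (\<lambda>\<omega>. (A \<omega> - \<mu>)\<^sup>2) \<le> expectation (\<lambda>\<omega>. (A \<omega>)\<^sup>2)"
    using second_moment_centered_le(2)[OF Am A2] by (simp add: AE)
  also have "\<dots> \<le> expectation (\<lambda>\<omega>. 3 * ((?u \<omega>)\<^sup>2 + (?v \<omega>)\<^sup>2 + (?w \<omega>)\<^sup>2))"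
    using A2 u2 v2 w2 unfolding A by (intro integral_mono sq3) (auto intro!: Bochner_Integration.integrable_add)
  also have "\<dots> = 3 * (expectation (\<lambda>\<omega>. (?u \<omega>)\<^sup>2) + expectation (\<lambda>\<omega>. (?v \<omega>)\<^sup>2) + expectation (\<lambda>\<omega>. (?w \<omega>)\<^sup>2))"
    using u2 v2 w2
    by (simp only: integral_mult_right_zero Bochner_Integration.integral_add Bochner_Integration.integrable_add)
  also have "\<dots> \<le> 3 * ((real p + real n + 1)\<^sup>2 * (3 * (dot \<gamma> \<gamma>)\<^sup>2)
       + (real p)\<^sup>2 * (105 / 2 * (dot \<gamma> \<gamma> ^ 4 + 1)) + 4 * (real n)\<^sup>2 * (3 * dot \<gamma> \<gamma> * sqnorm p \<gamma>))"
    using u_bound by (intro mult_left_mono add_mono v_bound w_bound) simp_all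
  finally show "expectation (\<lambda>\<omega>. (A \<omega> - \<mu>)\<^sup>2) \<le> 3 * ((real p + real n + 1)\<^sup>2 * (3 * (dot \<gamma> \<gamma>)\<^sup>2)
       + (real p)\<^sup>2 * (105 / 2 * (dot \<gamma> \<gamma> ^ 4 + 1)) + 4 * (real n)\<^sup>2 * (3 * dot \<gamma> \<gamma> * sqnorm p \<gamma>))" .
qed

end

section \<open>Deterministic algebra of the estimator\<close>

lemma square_sum_eq:
  fixes w :: "nat \<Rightarrow> real"
  shows "(\<Sum>i<n. w i)\<^sup>2 = (\<Sum>i<n. (w i)\<^sup>2) + 2 * (\<Sum>m<n. (\<Sum>i<m. w i) * w m)"
  by (induction n) (simp_all add: power2_sum algebra_simps)

text \<open>A pointwise identity, valid for every \<open>X\<close>, \<open>Y\<close>,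
  \<open>\<beta>\<close> and \<open>s2\<close>. Each coordinate of \<open>XtY\<close> is
  \<open>n \<beta> j\<close> plus a sum of the \<open>w i j\<close>; the diagonal and linear terms
  of its square go into the row statistics, and the off-diagonal pairs, ordered by their larger
  index, form the degenerate sum.\<close>

lemma sigma2_dicker_decomposition:
  fixes X :: "nat \<times> nat \<Rightarrow> real" and Y \<beta> :: "nat \<Rightarrow> real" and s2 :: real and n p :: nat
  assumes n: "0 < n"
  defines "b \<equiv> sqnorm p \<beta>"
    and "w \<equiv> \<lambda>i j. X (i, j) * Y i - \<beta> j"
    and "A \<equiv> \<lambda>i. (real p + real n + 1) * (Y i)\<^sup>2 - (\<Sum>j<p. (X (i, j) * Y i)\<^sup>2)
      - 2 * (real n - 1) * (\<Sum>j<p. \<beta> j * (X (i, j) * Y i))"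
  shows "real n * (real n + 1) * (sigma2_dicker n p X Y - s2) =
    (\<Sum>i<n. A i - ((real n + 1) * (b + s2) - 2 * real n * b))
    - 2 * (\<Sum>m<n. \<Sum>j<p. (\<Sum>i<m. w i j) * w m j)"
proof -
  let ?z = "\<lambda>i j. X (i, j) * Y i"
  let ?q = "\<lambda>i. \<Sum>j<p. (?z i j)\<^sup>2" and ?r = "\<lambda>i. \<Sum>j<p. \<beta> j * ?z i j"
  let ?F = "\<Sum>m<n. \<Sum>j<p. (\<Sum>i<m. w i j) * w m j"
  \<comment> \<open>Passing from \<open>w\<close> back to the uncentered products lowers the linear
    coefficient from \<open>2 n\<close> to \<open>2 (n - 1)\<close>, the one in
    \<open>A\<close>.\<close>
  have row: "(\<Sum>j<p. (w i j)\<^sup>2 + 2 * real n * \<beta> j * w i j) = ?q i + 2 * (real n - 1) * ?r i + (1 - 2 * real n) * b" for i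
  proof -
    have "(w i j)\<^sup>2 + 2 * real n * \<beta> j * w i j =
        (?z i j)\<^sup>2 + 2 * (real n - 1) * (\<beta> j * ?z i j) + (1 - 2 * real n) * (\<beta> j)\<^sup>2" for j
      by (simp add: w_def power2_eq_square algebra_simps)
    then show ?thesis
      by (simp only: sum.distrib b_def sqnorm_def flip: sum_distrib_left)
  qed
  have col: "(XtY n X Y j)\<^sup>2 = (\<Sum>i<n. (w i j)\<^sup>2 + 2 * real n * \<beta> j * w i j)
      + 2 * (\<Sum>m<n. (\<Sum>i<m. w i j) * w m j) + (real n)\<^sup>2 * (\<beta> j)\<^sup>2" for j
  proof -
    have "XtY n X Y j = (\<Sum>i<n. w i j) + real n * \<beta> j"
      by (simp add: XtY_def w_def sum_subtractf)
    then have "(XtY n X Y j)\<^sup>2 = (\<Sum>i<n. w i j)\<^sup>2 + 2 * real n * \<beta> j * (\<Sum>i<n. w i j) + (real n)\<^sup>2 * (\<beta> j)\<^sup>2"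
      by (simp add: power2_eq_square algebra_simps)
    then show ?thesis
      unfolding square_sum_eq by (simp add: sum.distrib sum_distrib_left)
  qed
  have F: "?F = (\<Sum>j<p. \<Sum>m<n. (\<Sum>i<m. w i j) * w m j)"
    by (rule sum.swap)
  have "sqnorm p (XtY n X Y) = (\<Sum>j<p. \<Sum>i<n. (w i j)\<^sup>2 + 2 * real n * \<beta> j * w i j) + 2 * ?F + (real n)\<^sup>2 * b"
    unfolding F by (simp only: sqnorm_def[of p "XtY n X Y"] col sum.distrib b_def sqnorm_def[of p \<beta>] sum_distrib_left)
  \<comment> \<open>Exchanging the sums regroups the column contributions by rows.\<close>
  also have "(\<Sum>j<p. \<Sum>i<n. (w i j)\<^sup>2 + 2 * real n * \<beta> j * w i j) =
      (\<Sum>i<n. ?q i + 2 * (real n - 1) * ?r i) + real n * ((1 - 2 * real n) * b)"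
    unfolding sum.swap[of _ "{..<n}"] row by (simp add: sum.distrib)
  finally have XtY: "sqnorm p (XtY n X Y) =
      (\<Sum>i<n. ?q i + 2 * (real n - 1) * ?r i) + real n * ((1 - 2 * real n) * b) + 2 * ?F + (real n)\<^sup>2 * b" .
  have "real n * (real n + 1) * sigma2_dicker n p X Y = (real p + real n + 1) * sqnorm n Y - sqnorm p (XtY n X Y)"
    using n unfolding sigma2_dicker_def right_diff_distrib by simp
  also have "\<dots> = (\<Sum>i<n. A i) - real n * ((1 - 2 * real n) * b) - 2 * ?F - (real n)\<^sup>2 * b"
  proof -
    have "(real p + real n + 1) * (Y i)\<^sup>2 = A i + (?q i + 2 * (real n - 1) * ?r i)" for i
      by (simp add: A_def)
    then have "(\<Sum>i<n. (real p + real n + 1) * (Y i)\<^sup>2) = (\<Sum>i<n. A i + (?q i + 2 * (real n - 1) * ?r i))"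
      by (intro sum.cong refl)
    then have "(real p + real n + 1) * sqnorm n Y = (\<Sum>i<n. A i) + (\<Sum>i<n. ?q i + 2 * (real n - 1) * ?r i)"
      unfolding sqnorm_def sum_distrib_left[of "real p + real n + 1"] by (simp only: sum.distrib)
    then show ?thesis
      unfolding XtY by simp
  qed
  finally have "real n * (real n + 1) * (sigma2_dicker n p X Y - s2) =
      (\<Sum>i<n. A i) - real n * ((1 - 2 * real n) * b) - 2 * ?F - (real n)\<^sup>2 * b - real n * (real n + 1) * s2"
    by (simp only: right_diff_distrib)
  moreover have "(\<Sum>i<n. A i - ((real n + 1) * (b + s2) - 2 * real n * b)) =
      (\<Sum>i<n. A i) - real n * ((real n + 1) * (b + s2) - 2 * real n * b)"
    unfolding sum_subtractf[of A] by simp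
  ultimately show ?thesis
    by (simp add: power2_eq_square algebra_simps)
qed

section \<open>Unconditional risk\<close>

text \<open>Independence amounts to the joint law being the product of the marginals, and reindexing
  a product measure along an injection gives again a product measure. The injection \<open>f\<close>
  can select a row, the noise column or the whole array.\<close>

lemma indep_vars_PiM_components:
  assumes N: "prob_space N" and ne: "I \<noteq> {}" and f: "inj_on f I" "f \<in> I \<rightarrow> K"
  shows "prob_space.indep_vars (PiM K (\<lambda>_. N)) (\<lambda>_. N) (\<lambda>j \<omega>. \<omega> (f j)) I"
proof -
  interpret prob_space "PiM K (\<lambda>_. N)"
    by (intro prob_space_PiM N)
  have rv: "random_variable N (\<lambda>\<omega>. \<omega> (f j))" if "j \<in> I" for j
    using f that by (intro measurable_component_singleton) auto
  have "distr (PiM K (\<lambda>_. N)) (PiM I (\<lambda>_. N)) (\<lambda>\<omega>. \<lambda>j\<in>I. \<omega> (f j)) = PiM I (\<lambda>_. N)"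
    by (rule distr_PiM_reindex[OF N f])
  also have "\<dots> = PiM I (\<lambda>j. distr (PiM K (\<lambda>_. N)) N (\<lambda>\<omega>. \<omega> (f j)))"
    using f distr_PiM_component[of K "\<lambda>_. N", OF N] by (intro PiM_cong) (auto simp: Pi_iff)
  finally show ?thesis
    using indep_vars_iff_distr_eq_PiM'[OF ne, of "\<lambda>j \<omega>. \<omega> (f j)" "\<lambda>_. N"] rv by simp
qed

section \<open>Rows of a standard Gaussian array\<close>

abbreviation std_normal :: "real measure" where
  "std_normal \<equiv> density lborel std_normal_density"

lemma prob_space_std_normal: "prob_space std_normal"
  by (rule prob_space_normal_density) simp

lemma prob_space_PiM_std_normal: "prob_space (PiM K (\<lambda>_. std_normal))"
  by (intro prob_space_PiM prob_space_std_normal)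

lemma std_gaussian_family_PiM:
  assumes "finite I" "I \<noteq> {}" and f: "inj_on f I" "f \<in> I \<rightarrow> K"
  shows "std_gaussian_family (PiM K (\<lambda>_. std_normal)) I (\<lambda>j \<omega>. \<omega> (f j))"
proof -
  interpret prob_space "PiM K (\<lambda>_. std_normal)"
    by (rule prob_space_PiM_std_normal)
  show ?thesis
  proof (unfold_locales)
    show "finite I" by fact
    show "indep_vars (\<lambda>_. borel) (\<lambda>j \<omega>. \<omega> (f j)) I"
      by (rule indep_vars_compose2[OF indep_vars_PiM_components[OF prob_space_std_normal assms(2) f],
          where Y = "\<lambda>_ t. t"]) simp
    fix j assume "j \<in> I"
    then have fj: "f j \<in> K"
      using f by auto
    have "distr (PiM K (\<lambda>_. std_normal)) lborel (\<lambda>\<omega>. \<omega> (f j)) =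
        distr (PiM K (\<lambda>_. std_normal)) std_normal (\<lambda>\<omega>. \<omega> (f j))"
      by (intro distr_cong) auto
    also have "\<dots> = std_normal"
      using distr_PiM_component[of K "\<lambda>_. std_normal", OF prob_space_std_normal fj] .
    finally show "distributed (PiM K (\<lambda>_. std_normal)) lborel (\<lambda>\<omega>. \<omega> (f j)) std_normal_density"
      using measurable_component_singleton[OF fj, of "\<lambda>_. std_normal"] by (simp add: distributed_def)
  qed
qed

text \<open>Column \<open>p\<close> of an \<open>n \<times> (p + 1)\<close> standard Gaussian array carries the noise, so that the
  response is a linear form in its row.\<close>

definition linear_response :: "nat \<Rightarrow> (nat \<Rightarrow> real) \<Rightarrow> (nat \<times> nat \<Rightarrow> real) \<Rightarrow> nat \<Rightarrow> real" where
  "linear_response p \<gamma> \<omega> i = (\<Sum>j<Suc p. \<gamma> j * \<omega> (i, j))"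

lemma design_row: "i < n \<Longrightarrow> gaussian_row (design_dist n (Suc p)) p (\<lambda>j \<omega>. \<omega> (i, j))"
  unfolding gaussian_row_def design_dist_def
  by (intro std_gaussian_family_PiM) (auto intro: inj_onI)

text \<open>Independent entries are grouped into the disjoint blocks
  \<open>{i} \<times> {..<Suc p}\<close>. The blocks are then relabelled by the column index alone,
  so that all rows take values in one common space.\<close>

lemma design_rows_indep:
  assumes n: "0 < n"
  shows "prob_space.indep_vars (design_dist n (Suc p)) (\<lambda>_. PiM {..<Suc p} (\<lambda>_. borel))
     (\<lambda>i \<omega>. \<lambda>j\<in>{..<Suc p}. \<omega> (i, j)) {..<n}"
proof -
  let ?K = "{..<n} \<times> {..<Suc p}"
  interpret prob_space "design_dist n (Suc p)"
    unfolding design_dist_def by (rule prob_space_PiM_std_normal)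
  have "indep_vars (\<lambda>_. std_normal) (\<lambda>k \<omega>. \<omega> k) ?K"
    using n unfolding design_dist_def
    by (intro indep_vars_PiM_components prob_space_std_normal) auto
  then have "indep_vars (\<lambda>i. PiM ({i} \<times> {..<Suc p}) (\<lambda>_. std_normal))
      (\<lambda>i \<omega>. restrict (\<lambda>k. \<omega> k) ({i} \<times> {..<Suc p})) {..<n}"
    by (rule indep_vars_restrict) (auto simp: disjoint_family_on_def)
  then have "indep_vars (\<lambda>_. PiM {..<Suc p} (\<lambda>_. borel))
      (\<lambda>i \<omega>. \<lambda>j\<in>{..<Suc p}. restrict \<omega> ({i} \<times> {..<Suc p}) (i, j)) {..<n}"
  proof (rule indep_vars_compose2[where Y = "\<lambda>i r. \<lambda>j\<in>{..<Suc p}. r (i, j)"])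
    fix i
    have "(\<lambda>r. r (i, j)) \<in> borel_measurable (PiM ({i} \<times> {..<Suc p}) (\<lambda>_. std_normal))" if "j < Suc p" for j
      using measurable_component_singleton[of "(i, j)" "{i} \<times> {..<Suc p}" "\<lambda>_. std_normal"] that by simp
    then show "(\<lambda>r. \<lambda>j\<in>{..<Suc p}. r (i, j)) \<in>
        measurable (PiM ({i} \<times> {..<Suc p}) (\<lambda>_. std_normal)) (PiM {..<Suc p} (\<lambda>_. borel))"
      by (intro measurable_restrict) auto
  qed
  then show ?thesis
    by (rule indep_vars_cong[THEN iffD1, rotated -1]) (auto simp: fun_eq_iff)
qed

text \<open>Combines the decomposition with the two moment bounds: the row part contributes
  \<open>n\<close> times the bound for one row, the degenerate part \<open>n^2 p (3 t)^2\<close>.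
  Here \<open>t\<close> is the variance of each response and \<open>(\<gamma> p)^2\<close> the noise
  variance.\<close>

lemma sigma2_dicker_second_moment:
  fixes \<gamma> :: "nat \<Rightarrow> real" and n p :: nat
  assumes n: "0 < n"
  defines "t \<equiv> sqnorm p \<gamma> + (\<gamma> p)\<^sup>2"
    and "Z \<equiv> \<lambda>\<omega>. real n * (real n + 1) * (sigma2_dicker n p \<omega> (linear_response p \<gamma> \<omega>) - (\<gamma> p)\<^sup>2)"
  shows "integrable (design_dist n (Suc p)) (\<lambda>\<omega>. (Z \<omega>)\<^sup>2)"
    "(\<integral>\<omega>. (Z \<omega>)\<^sup>2 \<partial>design_dist n (Suc p)) \<le>
       2 * (real n * (3 * ((real p + real n + 1)\<^sup>2 * (3 * t\<^sup>2) + (real p)\<^sup>2 * (105 / 2 * (t ^ 4 + 1))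
         + 4 * (real n)\<^sup>2 * (3 * t * sqnorm p \<gamma>))))
       + 8 * ((real n)\<^sup>2 * (real p * (3 * t)\<^sup>2))"
proof -
  let ?M = "design_dist n (Suc p)" and ?y = "linear_response p \<gamma>"
  let ?L = "3 * ((real p + real n + 1)\<^sup>2 * (3 * t\<^sup>2) + (real p)\<^sup>2 * (105 / 2 * (t ^ 4 + 1))
         + 4 * (real n)\<^sup>2 * (3 * t * sqnorm p \<gamma>))"
  let ?c = "(real n + 1) * t - 2 * real n * sqnorm p \<gamma>"
  interpret prob_space ?M
    unfolding design_dist_def by (rule prob_space_PiM_std_normal)
  define A where "A i \<omega> = (real p + real n + 1) * (?y \<omega> i)\<^sup>2 - (\<Sum>j<p. (\<omega> (i, j) * ?y \<omega> i)\<^sup>2)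
      - 2 * (real n - 1) * (\<Sum>j<p. \<gamma> j * (\<omega> (i, j) * ?y \<omega> i))" for i \<omega>
  define w where "w i \<omega> j = \<omega> (i, j) * ?y \<omega> i - \<gamma> j" for i \<omega> j
  define D where "D m f = (\<Sum>j<p. (\<Sum>i<m. f i j) * f m j)" for m and f :: "nat \<Rightarrow> nat \<Rightarrow> real"
  let ?V = "\<lambda>i \<omega>. \<lambda>j\<in>{..<p}. w i \<omega> j"
  let ?F = "\<lambda>\<omega>. \<Sum>m<n. D m (\<lambda>i. ?V i \<omega>)"
  let ?S = "\<lambda>\<omega>. \<Sum>i<n. A i \<omega> - ?c"
  have Z: "Z \<omega> = ?S \<omega> - 2 * ?F \<omega>" for \<omega>
  proof -
    have "D m (\<lambda>i. ?V i \<omega>) = (\<Sum>j<p. (\<Sum>i<m. w i \<omega> j) * w m \<omega> j)" for m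
      by (simp add: D_def cong: sum.cong_simp)
    then show ?thesis
      using sigma2_dicker_decomposition[OF n, of p \<omega> "?y \<omega>" "(\<gamma> p)\<^sup>2" \<gamma>]
      by (simp add: Z_def A_def w_def t_def)
  qed
  \<comment> \<open>Stated outside any interpretation, so that the facts about each row can be
    rewritten into the same terms.\<close>
  have lin: "std_gaussian_family.lin {..<Suc p} (\<lambda>j \<omega>. \<omega> (i, j)) \<gamma> \<omega> = ?y \<omega> i"
    and dot: "std_gaussian_family.dot {..<Suc p} \<gamma> \<gamma> = t" if "i < n" for i \<omega>
  proof -
    interpret gaussian_row ?M p "\<lambda>j \<omega>. \<omega> (i, j)"
      by (rule design_row[OF that])
    show "lin \<gamma> \<omega> = ?y \<omega> i"
      by (simp add: lin_def linear_response_def)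
    show "dot \<gamma> \<gamma> = t"
      by (simp add: dot_Suc t_def)
  qed
  \<comment> \<open>The response depends on the array only through its own row, so independence
    passes from the rows to the statistics built from them.\<close>
  have yr: "?y \<omega> i = (\<Sum>l<Suc p. \<gamma> l * (\<lambda>j\<in>{..<Suc p}. \<omega> (i, j)) l)" for \<omega> i
    unfolding linear_response_def by (intro sum.cong) auto
  have indA: "indep_vars (\<lambda>_. borel) (\<lambda>i \<omega>. A i \<omega> - ?c) {..<n}"
  proof -
    let ?r = "\<lambda>r. \<Sum>l<Suc p. \<gamma> l * r l"
    have "indep_vars (\<lambda>_. borel) (\<lambda>i \<omega>. (\<lambda>r. (real p + real n + 1) * (?r r)\<^sup>2 - (\<Sum>j<p. (r j * ?r r)\<^sup>2)
      - 2 * (real n - 1) * (\<Sum>j<p. \<gamma> j * (r j * ?r r)) - ?c) (\<lambda>j\<in>{..<Suc p}. \<omega> (i, j))) {..<n}"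
      by (rule indep_vars_compose2[OF design_rows_indep[OF n]])
        (auto intro!: borel_measurable_diff borel_measurable_times borel_measurable_sum borel_measurable_power
          measurable_component_singleton simp del: sum.lessThan_Suc)
    then show ?thesis
      by (rule indep_vars_cong[THEN iffD1, rotated -1])
        (auto simp: A_def yr fun_eq_iff simp del: sum.lessThan_Suc cong: sum.cong_simp)
  qed
  have indV: "indep_vars (\<lambda>_. PiM {..<p} (\<lambda>_. borel)) ?V {..<n}"
  proof -
    let ?r = "\<lambda>r. \<Sum>l<Suc p. \<gamma> l * r l"
    have "indep_vars (\<lambda>_. PiM {..<p} (\<lambda>_. borel))
        (\<lambda>i \<omega>. (\<lambda>r. \<lambda>j\<in>{..<p}. r j * ?r r - \<gamma> j) (\<lambda>j\<in>{..<Suc p}. \<omega> (i, j))) {..<n}"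
    proof (rule indep_vars_compose2[OF design_rows_indep[OF n]], rule measurable_restrict)
      fix j assume "j \<in> {..<p}"
      then show "(\<lambda>r. r j * ?r r - \<gamma> j) \<in> borel_measurable (PiM {..<Suc p} (\<lambda>_. borel))"
        by (intro borel_measurable_diff borel_measurable_times borel_measurable_sum borel_measurable_const
            measurable_component_singleton) auto
    qed
    then show ?thesis
      by (rule indep_vars_cong[THEN iffD1, rotated -1])
        (auto simp: w_def yr fun_eq_iff restrict_def simp del: sum.lessThan_Suc cong: sum.cong_simp)
  qed
  have A_row: "integrable ?M (\<lambda>\<omega>. (A i \<omega> - ?c)\<^sup>2)" "expectation (\<lambda>\<omega>. A i \<omega> - ?c) = 0"
    "expectation (\<lambda>\<omega>. (A i \<omega> - ?c)\<^sup>2) \<le> ?L" if "i < n" for i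
  proof -
    interpret gaussian_row ?M p "\<lambda>j \<omega>. \<omega> (i, j)"
      by (rule design_row[OF that])
    note * = row_statistic_bounds[OF n, of \<gamma>, unfolded lin[OF that] dot[OF that], folded A_def]
    show "integrable ?M (\<lambda>\<omega>. (A i \<omega> - ?c)\<^sup>2)" "expectation (\<lambda>\<omega>. A i \<omega> - ?c) = 0"
      "expectation (\<lambda>\<omega>. (A i \<omega> - ?c)\<^sup>2) \<le> ?L"
      by (fact *)+
  qed
  have V_row: "j < p \<Longrightarrow> integrable ?M (\<lambda>\<omega>. (?V i \<omega> j)\<^sup>2)" "j < p \<Longrightarrow> expectation (\<lambda>\<omega>. ?V i \<omega> j) = 0"
    "expectation (\<lambda>\<omega>. (\<Sum>j<p. v j * ?V i \<omega> j)\<^sup>2) \<le> 3 * t * (\<Sum>j<p. (v j)\<^sup>2)" if "i < n" for i j v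
  proof -
    interpret gaussian_row ?M p "\<lambda>j \<omega>. \<omega> (i, j)"
      by (rule design_row[OF that])
    note * = centered_product_bounds[of _ \<gamma>, unfolded lin[OF that] dot[OF that], folded w_def]
      and ** = centered_product_bounds(3)[of v \<gamma>, unfolded lin[OF that] dot[OF that], folded w_def]
    show "j < p \<Longrightarrow> integrable ?M (\<lambda>\<omega>. (?V i \<omega> j)\<^sup>2)" "j < p \<Longrightarrow> expectation (\<lambda>\<omega>. ?V i \<omega> j) = 0"
      using * by simp_all
    show "expectation (\<lambda>\<omega>. (\<Sum>j<p. v j * ?V i \<omega> j)\<^sup>2) \<le> 3 * t * (\<Sum>j<p. (v j)\<^sup>2)"
      using ** by (simp cong: sum.cong_simp)
  qed
  have Am: "i < n \<Longrightarrow> random_variable borel (\<lambda>\<omega>. A i \<omega> - ?c)" for i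
    using indA by (auto simp: indep_vars_def)
  have S2: "integrable ?M (\<lambda>\<omega>. (?S \<omega>)\<^sup>2)"
    using Am A_row by (intro square_integrable_sum) auto
  have SE: "expectation (\<lambda>\<omega>. (?S \<omega>)\<^sup>2) \<le> real n * ?L"
    using A_row by (intro second_moment_indep_sum_le[OF indA]) auto
  \<comment> \<open>The degenerate sum bound with \<open>K = 3 * t\<close> and all \<open>n\<close>
    increments.\<close>
  have F: "integrable ?M (\<lambda>\<omega>. (?F \<omega>)\<^sup>2) \<and> expectation (\<lambda>\<omega>. (?F \<omega>)\<^sup>2) \<le> (real n)\<^sup>2 * (real p * (3 * t)\<^sup>2)"
    unfolding D_def by (rule second_moment_degenerate_sum[OF indV V_row order_refl]) auto
  have Vm: "random_variable borel (\<lambda>\<omega>. ?V i \<omega> j)" if "i < n" "j < p" for i j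
  proof -
    have "random_variable (PiM {..<p} (\<lambda>_. borel)) (?V i)"
      using indV that by (auto simp: indep_vars_def)
    from measurable_compose[OF this measurable_component_singleton[of j]] that show ?thesis
      by simp
  qed
  have Fm: "random_variable borel ?F"
    unfolding D_def by (intro borel_measurable_sum borel_measurable_times Vm) auto
  have Sm: "random_variable borel ?S"
    by (intro borel_measurable_sum Am) auto
  have "integrable ?M (\<lambda>\<omega>. (?S \<omega> + - 2 * ?F \<omega>)\<^sup>2)"
  proof (rule square_integrable_add[OF Sm _ S2])
    show "random_variable borel (\<lambda>\<omega>. - 2 * ?F \<omega>)"
      by (intro borel_measurable_times Fm borel_measurable_const)
    show "integrable ?M (\<lambda>\<omega>. (- 2 * ?F \<omega>)\<^sup>2)"
      unfolding power_mult_distrib using F by (intro integrable_mult_right) auto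
  qed
  then show int: "integrable ?M (\<lambda>\<omega>. (Z \<omega>)\<^sup>2)"
    by (simp add: Z)
  have sq: "(a - 2 * b)\<^sup>2 \<le> 2 * a\<^sup>2 + 8 * b\<^sup>2" for a b :: real
    using zero_le_power2[of "a + 2 * b"] by (simp add: power2_eq_square algebra_simps)
  have "expectation (\<lambda>\<omega>. (Z \<omega>)\<^sup>2) \<le> expectation (\<lambda>\<omega>. 2 * (?S \<omega>)\<^sup>2 + 8 * (?F \<omega>)\<^sup>2)"
    using int S2 F unfolding Z by (intro integral_mono sq) (auto intro!: Bochner_Integration.integrable_add)
  also have "\<dots> = 2 * expectation (\<lambda>\<omega>. (?S \<omega>)\<^sup>2) + 8 * expectation (\<lambda>\<omega>. (?F \<omega>)\<^sup>2)"
    using S2 F by (subst Bochner_Integration.integral_add) (auto intro!: integrable_mult_right)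
  also have "\<dots> \<le> 2 * (real n * ?L) + 8 * ((real n)\<^sup>2 * (real p * (3 * t)\<^sup>2))"
    using SE F by (intro add_mono mult_left_mono) auto
  finally show "expectation (\<lambda>\<omega>. (Z \<omega>)\<^sup>2) \<le> 2 * (real n * ?L) + 8 * ((real n)\<^sup>2 * (real p * (3 * t)\<^sup>2))" .
qed

section \<open>Conditional risk given the design\<close>

lemma sigma2_dicker_cong:
  assumes "\<And>i j. i < n \<Longrightarrow> j < p \<Longrightarrow> X (i, j) = X' (i, j)" "\<And>i. i < n \<Longrightarrow> Y i = Y' i"
  shows "sigma2_dicker n p X Y = sigma2_dicker n p X' Y'"
  unfolding sigma2_dicker_def sqnorm_def XtY_def using assms by (simp cong: sum.cong_simp)

lemma sigma2_dicker_measurable: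
  assumes "\<And>i j. i < n \<Longrightarrow> j < p \<Longrightarrow> (\<lambda>\<omega>. X \<omega> (i, j)) \<in> borel_measurable M"
    and "\<And>i. i < n \<Longrightarrow> (\<lambda>\<omega>. Y \<omega> i) \<in> borel_measurable M"
  shows "(\<lambda>\<omega>. sigma2_dicker n p (X \<omega>) (Y \<omega>)) \<in> borel_measurable M"
  unfolding sigma2_dicker_def sqnorm_def XtY_def using assms
  by (intro borel_measurable_diff borel_measurable_times borel_measurable_const borel_measurable_sum
      borel_measurable_power) auto

lemma sets_response_dist: "sets (response_dist n p X \<beta> s2) = sets (PiM {..<n} (\<lambda>_. borel))"
  unfolding response_dist_def by (intro sets_PiM_cong) auto

text \<open>The conditional law is the affine image of the noise column: the shifted and scaled
  entries are independent with the required normal marginals. This realises the response on the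
  enlarged array.\<close>

lemma response_dist_eq_distr:
  assumes n: "0 < n" and s2: "0 < s2"
  shows "response_dist n p X \<beta> s2 =
    distr (PiM ({..<n} \<times> {p}) (\<lambda>_. std_normal)) (PiM {..<n} (\<lambda>_. borel))
      (\<lambda>e. \<lambda>i\<in>{..<n}. mean_vec p X \<beta> i + sqrt s2 * e (i, p))"
proof -
  let ?E = "PiM ({..<n} \<times> {p}) (\<lambda>_. std_normal)"
  interpret std_gaussian_family ?E "{..<n}" "\<lambda>i e. e (i, p)"
    using n by (intro std_gaussian_family_PiM) (auto intro: inj_onI)
  let ?Y = "\<lambda>i e. mean_vec p X \<beta> i + sqrt s2 * e (i, p)"
  have ind: "indep_vars (\<lambda>_. borel) ?Y {..<n}"
    by (rule indep_vars_compose2[OF indep, where Y = "\<lambda>i t. mean_vec p X \<beta> i + sqrt s2 * t"]) simp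
  have "distr ?E (PiM {..<n} (\<lambda>_. borel)) (\<lambda>e. \<lambda>i\<in>{..<n}. ?Y i e) = PiM {..<n} (\<lambda>i. distr ?E borel (?Y i))"
    using n ind by (subst indep_vars_iff_distr_eq_PiM'[symmetric]) (auto simp: indep_vars_def)
  also have "\<dots> = response_dist n p X \<beta> s2"
    unfolding response_dist_def
  proof (intro PiM_cong refl)
    fix i assume "i \<in> {..<n}"
    then have "distributed ?E lborel (?Y i) (normal_density (mean_vec p X \<beta> i) (sqrt s2))"
      using normal_density_affine[OF std_normal[of i], of "sqrt s2" "mean_vec p X \<beta> i"] s2 by simp
    then show "distr ?E borel (?Y i) = density lborel (normal_density (mean_vec p X \<beta> i) (sqrt s2))"
      by (simp add: distributed_def cong: distr_cong)
  qed
  finally show ?thesis ..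
qed

text \<open>A nonnegative integral, so that no integrability for a fixed design has to be shown and
  Tonelli applies directly.\<close>

definition conditional_risk ::
  "nat \<Rightarrow> nat \<Rightarrow> (nat \<Rightarrow> real) \<Rightarrow> real \<Rightarrow> (nat \<times> nat \<Rightarrow> real) \<Rightarrow> ennreal" where
  "conditional_risk n p \<beta> s2 X =
     (\<integral>\<^sup>+ Y. ennreal ((sigma2_dicker n p X Y - s2)\<^sup>2) \<partial>response_dist n p X \<beta> s2)"

lemma borel_measurable_sigma2_dicker_error:
  "(\<lambda>Y. sigma2_dicker n p X Y - s2) \<in> borel_measurable (response_dist n p X \<beta> s2)"
proof -
  have "(\<lambda>Y. sigma2_dicker n p X Y - s2) \<in> borel_measurable (PiM {..<n} (\<lambda>_. borel))"
    by (intro borel_measurable_diff sigma2_dicker_measurable borel_measurable_const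
        measurable_component_singleton) auto
  then show ?thesis
    using measurable_cong_sets[OF sets_response_dist refl] by blast
qed

lemma conditional_Chebyshev:
  assumes \<xi>: "0 < \<xi>"
  shows "emeasure (response_dist n p X \<beta> s2)
      {Y \<in> space (response_dist n p X \<beta> s2). \<bar>sigma2_dicker n p X Y - s2\<bar> \<ge> \<xi>}
    \<le> ennreal (1 / \<xi>\<^sup>2) * conditional_risk n p \<beta> s2 X"
proof -
  let ?R = "response_dist n p X \<beta> s2" and ?d = "\<lambda>Y. sigma2_dicker n p X Y - s2"
  note [measurable] = borel_measurable_sigma2_dicker_error[of n p X s2 \<beta>]
  \<comment> \<open>Brings the deviation event into the form required by Markov's inequality for
    nonnegative integrals.\<close>
  have iff: "\<bar>d\<bar> \<ge> \<xi> \<longleftrightarrow> 1 \<le> ennreal (1 / \<xi>\<^sup>2) * ennreal (d\<^sup>2)" for d :: real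
  proof -
    have "\<bar>d\<bar> \<ge> \<xi> \<longleftrightarrow> \<xi>\<^sup>2 \<le> d\<^sup>2"
      using \<xi> abs_le_square_iff[of \<xi> d] by simp
    also have "\<dots> \<longleftrightarrow> 1 \<le> 1 / \<xi>\<^sup>2 * d\<^sup>2"
      using \<xi> by (simp add: field_simps)
    also have "\<dots> \<longleftrightarrow> 1 \<le> ennreal (1 / \<xi>\<^sup>2 * d\<^sup>2)"
      by simp
    finally show ?thesis
      by (simp only: ennreal_mult' zero_le_divide_1_iff zero_le_power2)
  qed
  have "emeasure ?R {Y \<in> space ?R. 1 \<le> ennreal (1 / \<xi>\<^sup>2) * ennreal ((?d Y)\<^sup>2)}
      \<le> ennreal (1 / \<xi>\<^sup>2) * (\<integral>\<^sup>+ Y. ennreal ((?d Y)\<^sup>2) * indicator (space ?R) Y \<partial>?R)"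
    by (rule nn_integral_Markov_inequality) auto
  also have "(\<integral>\<^sup>+ Y. ennreal ((?d Y)\<^sup>2) * indicator (space ?R) Y \<partial>?R) = conditional_risk n p \<beta> s2 X"
    unfolding conditional_risk_def by (intro nn_integral_cong) simp
  finally show ?thesis
    unfolding iff .
qed

text \<open>Tonelli's theorem for the array split into the design columns and the noise column:
  integrating out the noise gives the conditional risk, and integrating both gives the unconditional
  one.\<close>

lemma conditional_risk:
  fixes \<beta> :: "nat \<Rightarrow> real" and n p :: nat and s2 :: real
  assumes n: "0 < n" and s2: "0 < s2"
  defines "\<gamma> \<equiv> \<beta>(p := sqrt s2)"
  shows conditional_risk_measurable: "conditional_risk n p \<beta> s2 \<in> borel_measurable (design_dist n p)"
    and integral_conditional_risk: "(\<integral>\<^sup>+ X. conditional_risk n p \<beta> s2 X \<partial>design_dist n p) =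
      (\<integral>\<^sup>+ \<omega>. ennreal ((sigma2_dicker n p \<omega> (linear_response p \<gamma> \<omega>) - s2)\<^sup>2) \<partial>design_dist n (Suc p))"
proof -
  let ?I = "{..<n} \<times> {..<p}" and ?J = "{..<n} \<times> {p}"
  let ?MI = "PiM ?I (\<lambda>_. std_normal)" and ?MJ = "PiM ?J (\<lambda>_. std_normal)"
  let ?M = "PiM (?I \<union> ?J) (\<lambda>_. std_normal)"
  define h where "h \<omega> = ennreal ((sigma2_dicker n p \<omega> (linear_response p \<gamma> \<omega>) - s2)\<^sup>2)" for \<omega>
  interpret product_sigma_finite "\<lambda>_. std_normal"
    using prob_space_std_normal
    by (auto simp: product_sigma_finite_def intro: prob_space_imp_sigma_finite)
  interpret J: prob_space ?MJ
    by (rule prob_space_PiM_std_normal)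
  have un: "?I \<union> ?J = {..<n} \<times> {..<Suc p}"
    by auto
  have comp: "(\<lambda>\<omega>. \<omega> (i, j)) \<in> borel_measurable ?M" if "i < n" "j < Suc p" for i j
    using measurable_component_singleton[of "(i, j)" "?I \<union> ?J" "\<lambda>_. std_normal"] that unfolding un by auto
  have hm [measurable]: "h \<in> borel_measurable ?M"
    unfolding h_def linear_response_def
    by (intro measurable_compose[OF _ measurable_ennreal] borel_measurable_power borel_measurable_diff
        sigma2_dicker_measurable borel_measurable_sum borel_measurable_times borel_measurable_const comp) auto
  have risk: "conditional_risk n p \<beta> s2 X = (\<integral>\<^sup>+ e. h (merge ?I ?J (X, e)) \<partial>?MJ)" for X
  proof -
    let ?Y = "\<lambda>e. \<lambda>i\<in>{..<n}. mean_vec p X \<beta> i + sqrt s2 * e (i, p)"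
    have Ym: "?Y \<in> measurable ?MJ (PiM {..<n} (\<lambda>_. borel))"
    proof (rule measurable_restrict)
      fix i assume "i \<in> {..<n}"
      then have "(\<lambda>e. e (i, p)) \<in> borel_measurable ?MJ"
        using measurable_component_singleton[of "(i, p)" ?J "\<lambda>_. std_normal"] by simp
      then show "(\<lambda>e. mean_vec p X \<beta> i + sqrt s2 * e (i, p)) \<in> borel_measurable ?MJ"
        by measurable
    qed
    have dm: "(\<lambda>Y. ennreal ((sigma2_dicker n p X Y - s2)\<^sup>2)) \<in> borel_measurable (PiM {..<n} (\<lambda>_. borel))"
      by (intro measurable_compose[OF _ measurable_ennreal] borel_measurable_power borel_measurable_diff
          sigma2_dicker_measurable borel_measurable_const measurable_component_singleton) auto
    have "conditional_risk n p \<beta> s2 X = (\<integral>\<^sup>+ e. ennreal ((sigma2_dicker n p X (?Y e) - s2)\<^sup>2) \<partial>?MJ)"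
      using nn_integral_distr[OF Ym, of "\<lambda>Y. ennreal ((sigma2_dicker n p X Y - s2)\<^sup>2)"] dm
      by (simp only: conditional_risk_def response_dist_eq_distr[OF n s2] measurable_distr_eq1)
    also have "\<dots> = (\<integral>\<^sup>+ e. h (merge ?I ?J (X, e)) \<partial>?MJ)"
    proof (rule nn_integral_cong)
      fix e
      \<comment> \<open>The estimator reads only columns below \<open>p\<close>, where the merged
        array is \<open>X\<close>; column \<open>p\<close> enters through the response
        alone.\<close>
      have "sigma2_dicker n p X (?Y e) =
          sigma2_dicker n p (merge ?I ?J (X, e)) (linear_response p \<gamma> (merge ?I ?J (X, e)))"
        by (rule sigma2_dicker_cong)
          (auto simp: merge_def linear_response_def mean_vec_def \<gamma>_def mult.commute intro!: sum.cong)
      then show "ennreal ((sigma2_dicker n p X (?Y e) - s2)\<^sup>2) = h (merge ?I ?J (X, e))"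
        by (simp add: h_def)
    qed
    finally show ?thesis .
  qed
  have "(\<lambda>X. \<integral>\<^sup>+ e. h (merge ?I ?J (X, e)) \<partial>?MJ) \<in> borel_measurable ?MI"
    by measurable
  then show "conditional_risk n p \<beta> s2 \<in> borel_measurable (design_dist n p)"
    unfolding design_dist_def risk[abs_def] .
  have "(\<integral>\<^sup>+ X. conditional_risk n p \<beta> s2 X \<partial>?MI) = integral\<^sup>N ?M h"
    unfolding risk by (rule product_nn_integral_fold[symmetric]) (auto simp: hm)
  then show "(\<integral>\<^sup>+ X. conditional_risk n p \<beta> s2 X \<partial>design_dist n p) =
      (\<integral>\<^sup>+ \<omega>. ennreal ((sigma2_dicker n p \<omega> (linear_response p \<gamma> \<omega>) - s2)\<^sup>2) \<partial>design_dist n (Suc p))"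
    unfolding design_dist_def un h_def .
qed

text \<open>All terms of the second moment bound are at most constants times \<open>n^3\<close>,
  since \<open>p \<le> a n\<close> and \<open>t \<le> 2 B\<close>; dividing by
  \<open>(n (n + 1))^2\<close> leaves order \<open>1 / n\<close>.\<close>

lemma integral_conditional_risk_le:
  fixes \<beta> :: "nat \<Rightarrow> real" and n p :: nat and s2 a B :: real
  assumes n: "0 < n" and s2: "0 < s2" "s2 \<le> B" and \<beta>: "sqnorm p \<beta> \<le> B" and p: "real p \<le> a * real n"
  defines "C \<equiv> 6 * ((a + 2)\<^sup>2 * (3 * (2 * B)\<^sup>2) + a\<^sup>2 * (105 / 2 * ((2 * B) ^ 4 + 1)) + 4 * (3 * (2 * B) * B))
      + 8 * (a * (3 * (2 * B))\<^sup>2)"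
  shows "(\<integral>\<^sup>+ X. conditional_risk n p \<beta> s2 X \<partial>design_dist n p) \<le> ennreal (C / real n)" and "0 \<le> C"
proof -
  let ?M = "design_dist n (Suc p)"
  define \<gamma> where "\<gamma> = \<beta>(p := sqrt s2)"
  define t where "t = sqnorm p \<gamma> + (\<gamma> p)\<^sup>2"
  let ?d = "\<lambda>\<omega>. sigma2_dicker n p \<omega> (linear_response p \<gamma> \<omega>) - s2"
  have \<gamma>: "sqnorm p \<gamma> = sqnorm p \<beta>" "(\<gamma> p)\<^sup>2 = s2"
    using s2 by (simp_all add: \<gamma>_def sqnorm_def)
  have sq0: "0 \<le> sqnorm p \<beta>"
    by (simp add: sqnorm_def sum_nonneg)
  have t: "0 \<le> t" "t \<le> 2 * B"
    using \<gamma> s2 \<beta> sq0 by (simp_all add: t_def)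
  have B: "0 \<le> B"
    using s2 by simp
  have a: "0 \<le> a"
    using p n by (metis mult_less_0_iff not_le of_nat_0_le_iff of_nat_0_less_iff order_trans)
  show "0 \<le> C"
    unfolding C_def using a B by simp
  have int: "integrable ?M (\<lambda>\<omega>. (real n * (real n + 1) * ?d \<omega>)\<^sup>2)"
    using sigma2_dicker_second_moment(1)[OF n, where \<gamma> = \<gamma> and p = p] by (simp add: \<gamma>)
  have le: "(\<integral>\<omega>. (real n * (real n + 1) * ?d \<omega>)\<^sup>2 \<partial>?M) \<le>
       2 * (real n * (3 * ((real p + real n + 1)\<^sup>2 * (3 * t\<^sup>2) + (real p)\<^sup>2 * (105 / 2 * (t ^ 4 + 1))
         + 4 * (real n)\<^sup>2 * (3 * t * sqnorm p \<beta>))))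
       + 8 * ((real n)\<^sup>2 * (real p * (3 * t)\<^sup>2))"
    using sigma2_dicker_second_moment(2)[OF n, where \<gamma> = \<gamma> and p = p] by (simp only: \<gamma> flip: t_def) (simp add: t_def \<gamma>)
  \<comment> \<open>Since \<open>n \<ge> 1\<close>, the summand 1 is absorbed into another
    \<open>n\<close>.\<close>
  have "real p + real n + 1 \<le> (a + 2) * real n"
    using p n by (simp add: algebra_simps)
  then have "2 * (real n * (3 * ((real p + real n + 1)\<^sup>2 * (3 * t\<^sup>2) + (real p)\<^sup>2 * (105 / 2 * (t ^ 4 + 1))
         + 4 * (real n)\<^sup>2 * (3 * t * sqnorm p \<beta>)))) + 8 * ((real n)\<^sup>2 * (real p * (3 * t)\<^sup>2)) \<le>
      2 * (real n * (3 * (((a + 2) * real n)\<^sup>2 * (3 * (2 * B)\<^sup>2) + (a * real n)\<^sup>2 * (105 / 2 * ((2 * B) ^ 4 + 1))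
         + 4 * (real n)\<^sup>2 * (3 * (2 * B) * B)))) + 8 * ((real n)\<^sup>2 * (a * real n * (3 * (2 * B))\<^sup>2))"
    using t p a B sq0 \<beta>
    by (intro add_mono mult_left_mono mult_mono power_mono add_right_mono) auto
  also have "\<dots> = C * real n ^ 3"
    unfolding C_def by (simp add: power2_eq_square power3_eq_cube algebra_simps)
  finally have "(real n * (real n + 1))\<^sup>2 * (\<integral>\<omega>. (?d \<omega>)\<^sup>2 \<partial>?M) \<le> C * real n ^ 3"
    using le by (simp add: power_mult_distrib)
  moreover have "C * real n ^ 3 \<le> (real n * (real n + 1))\<^sup>2 * (C / real n)"
  proof -
    have "(real n * (real n + 1))\<^sup>2 * (C / real n) = C * real n ^ 3 + C * (real n * (2 * real n + 1))"
      using n by (simp add: power2_eq_square power3_eq_cube field_simps)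
    then show ?thesis
      using \<open>0 \<le> C\<close> by simp
  qed
  ultimately have "(real n * (real n + 1))\<^sup>2 * (\<integral>\<omega>. (?d \<omega>)\<^sup>2 \<partial>?M) \<le> (real n * (real n + 1))\<^sup>2 * (C / real n)"
    by (rule order_trans)
  then have E: "(\<integral>\<omega>. (?d \<omega>)\<^sup>2 \<partial>?M) \<le> C / real n"
    by (rule mult_left_le_imp_le) (use n in simp)
  have int': "integrable ?M (\<lambda>\<omega>. (?d \<omega>)\<^sup>2)"
    using integrable_mult_right[OF int, of "inverse ((real n * (real n + 1))\<^sup>2)"] n
    by (simp add: power_mult_distrib)
  have "(\<integral>\<^sup>+ X. conditional_risk n p \<beta> s2 X \<partial>design_dist n p) = (\<integral>\<^sup>+ \<omega>. ennreal ((?d \<omega>)\<^sup>2) \<partial>?M)"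
    unfolding \<gamma>_def by (rule integral_conditional_risk[OF n s2(1)])
  also have "\<dots> = ennreal (\<integral>\<omega>. (?d \<omega>)\<^sup>2 \<partial>?M)"
    using int' by (intro nn_integral_eq_integral) auto
  also have "\<dots> \<le> ennreal (C / real n)"
    using E by (rule ennreal_leI)
  finally show "(\<integral>\<^sup>+ X. conditional_risk n p \<beta> s2 X \<partial>design_dist n p) \<le> ennreal (C / real n)" .
qed

section \<open>Choice of the sets and conclusion\<close>

theorem theorem1:
  fixes p :: "nat \<Rightarrow> nat" and c :: real
    and \<beta> :: "nat \<Rightarrow> nat \<Rightarrow> real" and sigma2 :: "nat \<Rightarrow> real"
  assumes ratio: "(\<lambda>n. real (p n) / real n) \<longlonglongrightarrow> c"
    and c_ge: "c \<ge> 1"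
    and sigma_pos: "\<And>n. sigma2 n > 0"
    and bounded: "\<exists>B. \<forall>n. sigma2 n \<le> B \<and> sqnorm (p n) (\<beta> n) \<le> B"
  shows "\<exists>A :: nat \<Rightarrow> (nat \<times> nat \<Rightarrow> real) set. \<exists>C :: real.
     (\<forall>n. A n \<in> sets (design_dist n (p n))) \<and>
     ((\<lambda>n. measure (design_dist n (p n)) (A n)) \<longlonglongrightarrow> 1) \<and>
     (\<forall>n X \<xi>. X \<in> A n \<longrightarrow> \<xi> > 0 \<longrightarrow>
        measure (response_dist n (p n) X (\<beta> n) (sigma2 n))
          {Y \<in> space (response_dist n (p n) X (\<beta> n) (sigma2 n)).
             \<bar>sigma2_dicker n (p n) X Y - sigma2 n\<bar> \<ge> \<xi>}
        \<le> C * g_fun c n (sqnorm n (mean_vec (p n) X (\<beta> n))) (sigma2 n)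
            / (\<xi>\<^sup>2 * sqrt (real n)))"
proof -
  obtain B where B: "\<And>n. sigma2 n \<le> B" "\<And>n. sqnorm (p n) (\<beta> n) \<le> B"
    using bounded by blast
  let ?D = "\<lambda>n. design_dist n (p n)" and ?W = "\<lambda>n. conditional_risk n (p n) (\<beta> n) (sigma2 n)"
  \<comment> \<open>For \<open>n = 0\<close> the right-hand side of the claim is 0 because division
    by zero yields 0, and the probability is 1 for small \<open>\<xi>\<close>; the empty set makes
    the claim vacuous there.\<close>
  define A where "A n = (if n = 0 then {} else {X \<in> space (?D n). ?W n X < ennreal (1 / sqrt (real n))})" for n
  have W [measurable]: "?W n \<in> borel_measurable (?D n)" if "0 < n" for n
    by (rule conditional_risk_measurable[OF that sigma_pos])
  have A_sets: "A n \<in> sets (?D n)" for n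
  proof (cases "n = 0")
    case False
    then have "{X \<in> space (?D n). ?W n X < ennreal (1 / sqrt (real n))} \<in> sets (?D n)"
      by (intro borel_measurable_less W) auto
    then show ?thesis
      using False by (simp add: A_def)
  qed (simp add: A_def)
  \<comment> \<open>The risk constant with \<open>a = c + 1\<close>, which eventually exceeds
    \<open>p / n\<close>. It only governs the speed at which the probability of \<open>A n\<close>
    tends to 1; the constant in the conclusion is 1.\<close>
  define C where "C = 6 * ((c + 1 + 2)\<^sup>2 * (3 * (2 * B)\<^sup>2) + (c + 1)\<^sup>2 * (105 / 2 * ((2 * B) ^ 4 + 1))
      + 4 * (3 * (2 * B) * B)) + 8 * ((c + 1) * (3 * (2 * B))\<^sup>2)"
  have risk: "(\<integral>\<^sup>+ X. ?W n X \<partial>?D n) \<le> ennreal (C / real n)" "0 \<le> C"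
    if "0 < n" "real (p n) \<le> (c + 1) * real n" for n
    unfolding C_def using integral_conditional_risk_le[OF that(1) sigma_pos B that(2)] by simp_all
  have ev: "\<forall>\<^sub>F n in sequentially. 1 - C / sqrt (real n) \<le> measure (?D n) (A n)"
  proof -
    have "\<forall>\<^sub>F n in sequentially. real (p n) / real n < c + 1"
      using order_tendstoD(2)[OF ratio, of "c + 1"] by simp
    then show ?thesis
      using eventually_gt_at_top[of 0]
    proof eventually_elim
      case (elim n)
      interpret prob_space "?D n"
        unfolding design_dist_def by (rule prob_space_PiM_std_normal)
      have s: "0 < sqrt (real n)"
        using elim by simp
      have pn: "real (p n) \<le> (c + 1) * real n"
        using elim by (simp add: field_simps)
      have C0: "0 \<le> C"
        using risk(2)[OF _ pn] elim by simp
      \<comment> \<open>The complement in the form of Markov's inequality, including designs of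
        infinite risk.\<close>
      have "space (?D n) - A n = {X \<in> space (?D n). 1 \<le> ennreal (sqrt (real n)) * ?W n X}"
      proof -
        have "\<not> w < ennreal (1 / sqrt (real n)) \<longleftrightarrow> 1 \<le> ennreal (sqrt (real n)) * w" for w
        proof (cases w)
          case (real r)
          then show ?thesis
            using s by (simp add: ennreal_less_iff not_less field_simps flip: ennreal_mult')
        next
          case top
          then show ?thesis
            using s by (simp add: ennreal_mult_top)
        qed
        then show ?thesis
          using elim by (auto simp: A_def)
      qed
      then have "emeasure (?D n) (space (?D n) - A n) \<le>
          ennreal (sqrt (real n)) * (\<integral>\<^sup>+ X. ?W n X * indicator (space (?D n)) X \<partial>?D n)"
        using W[of n] elim by (simp only:) (rule nn_integral_Markov_inequality, auto)
      also have "(\<integral>\<^sup>+ X. ?W n X * indicator (space (?D n)) X \<partial>?D n) = (\<integral>\<^sup>+ X. ?W n X \<partial>?D n)"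
        by (intro nn_integral_cong) simp
      also have "ennreal (sqrt (real n)) * \<dots> \<le> ennreal (sqrt (real n)) * ennreal (C / real n)"
        using risk(1)[OF _ pn] elim by (intro mult_left_mono) auto
      also have "\<dots> = ennreal (C / sqrt (real n))"
      proof -
        have "sqrt (real n) * (C / real n) = C / sqrt (real n)"
          using s by (simp add: field_simps)
        then show ?thesis
          using C0 s by (simp flip: ennreal_mult')
      qed
      finally have "prob (space (?D n) - A n) \<le> C / sqrt (real n)"
        using C0 by (simp add: emeasure_eq_measure)
      then show ?case
        using prob_compl[OF A_sets[of n]] by simp
    qed
  qed
  have "(\<lambda>n. 1 - C / sqrt (real n)) \<longlonglongrightarrow> 1 - 0"
    by (intro tendsto_intros tendsto_divide_0[OF tendsto_const] filterlim_at_top_imp_at_infinity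
        filterlim_compose[OF sqrt_at_top filterlim_real_sequentially])
  then have lim: "(\<lambda>n. measure (?D n) (A n)) \<longlonglongrightarrow> 1"
  proof (intro tendsto_sandwich[OF ev _ _ tendsto_const])
    have "measure (?D n) (A n) \<le> 1" for n
      unfolding design_dist_def by (rule prob_space.prob_le_1[OF prob_space_PiM_std_normal])
    then show "\<forall>\<^sub>F n in sequentially. measure (?D n) (A n) \<le> 1"
      by simp
  qed simp
  \<comment> \<open>The explicit factor 1 is the witness for the constant of the statement.\<close>
  have "measure (response_dist n (p n) X (\<beta> n) (sigma2 n))
          {Y \<in> space (response_dist n (p n) X (\<beta> n) (sigma2 n)). \<bar>sigma2_dicker n (p n) X Y - sigma2 n\<bar> \<ge> \<xi>}
        \<le> 1 * g_fun c n (sqnorm n (mean_vec (p n) X (\<beta> n))) (sigma2 n) / (\<xi>\<^sup>2 * sqrt (real n))"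
    if X: "X \<in> A n" and \<xi>: "\<xi> > 0" for n X \<xi>
  proof -
    let ?R = "response_dist n (p n) X (\<beta> n) (sigma2 n)"
    let ?e = "{Y \<in> space ?R. \<bar>sigma2_dicker n (p n) X Y - sigma2 n\<bar> \<ge> \<xi>}"
    have n: "0 < n" and WX: "?W n X \<le> ennreal (1 / sqrt (real n))"
      using X by (auto simp: A_def split: if_splits)
    have "emeasure ?R ?e \<le> ennreal (1 / \<xi>\<^sup>2) * ?W n X"
      by (rule conditional_Chebyshev[OF \<xi>])
    also have "\<dots> \<le> ennreal (1 / \<xi>\<^sup>2) * ennreal (1 / sqrt (real n))"
      by (intro mult_left_mono WX) simp
    also have "\<dots> = ennreal (1 / (\<xi>\<^sup>2 * sqrt (real n)))"
      by (simp flip: ennreal_mult')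
    finally have "measure ?R ?e \<le> 1 / (\<xi>\<^sup>2 * sqrt (real n))"
      unfolding measure_def by (rule enn2real_leI[rotated]) simp
    \<comment> \<open>Every other summand of \<open>g_fun\<close> is nonnegative, so its leading 1
      is a lower bound.\<close>
    also have "1 \<le> g_fun c n (sqnorm n (mean_vec (p n) X (\<beta> n))) (sigma2 n)"
    proof -
      have "0 \<le> sqnorm n (mean_vec (p n) X (\<beta> n))"
        by (simp add: sqnorm_def sum_nonneg)
      then show ?thesis
        using c_ge sigma_pos[of n] by (simp add: g_fun_def)
    qed
    finally show ?thesis
      by (simp add: divide_right_mono)
  qed
  then show ?thesis
    using A_sets lim by blast
qed

end
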